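(* Let $(G,\Gamma)$ be a $d$-periodic graph with $n=|V/\Gamma|$. There is an inclusion reversing correspondence $\Sigma\mapsto\mathcal{F}(\Sigma)$ between subgroups $\Sigma$ with $\Gamma\subset\Sigma\subset Aut(G,\Gamma)$ and a finite system of non-empty affine linear sections of $(\mathbb{R}^d)^{n-1}\times\Omega(d)$ which parametrize periodic placements with a specified crystallographic symmetry. That is: for each such $\Sigma$, the set $\mathcal{F}(\Sigma)$ of parameter points of placements with crystallographic symmetry $\Sigma$ is a non-empty intersection of $(\mathbb{R}^d)^{n-1}\times\Omega(d)$ with an affine linear subspace of $\mathbb{R}^{dn+\binom{d}{2}}$; the collection of all the sets $\mathcal{F}(\Sigma)$ is finite; and $\Sigma_1\subset\Sigma_2$ implies $\mathcal{F}(\Sigma_2)\subset\mathcal{F}(\Sigma_1)$.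
   Context: A $d$-periodic graph $(G,\Gamma)$ consists of an infinite connected graph $G=(V,E)$ and a free Abelian group $\Gamma\subset Aut(G)$ of rank $d$, acting freely on $V$, such that the quotient multigraph $G/\Gamma$ is finite. $Aut(G,\Gamma)$ denotes the normalizer of $\Gamma$ in $Aut(G)$. For $\sigma\in Aut(G,\Gamma)$, $C_\sigma$ is the automorphism $\gamma\mapsto\sigma\gamma\sigma^{-1}$ of $\Gamma$. A periodic placement $(p,\pi)$ of $(G,\Gamma)$ in $\mathbb{R}^d$ consists of a function $p:V\to\mathbb{R}^d$ and an injective homomorphism $\pi:\Gamma\to\mathcal{T}(\mathbb{R}^d)$ into the group of translations of $\mathbb{R}^d$ (identified with $\mathbb{R}^d$), whose image is a lattice of rank $d$, such that $p\circ\gamma=\pi(\gamma)\circ p$ for all $\gamma\in\Gamma$. Parameters: fix representatives $v_0,\dots,v_{n-1}$ of the $\Gamma$-orbits on $V$ and an isomorphism $\mathbb{Z}^d\approx\Gamma$, with $e_1,\dots,e_d$ the standard basis of $\mathbb{Z}^d$. For a placement $(p,\pi)$ let $\Lambda\in GL(d,\mathbb{R})$ be the matrix with columns $\pi(e_1),\dots,\pi(e_d)$; its parameter point is $(t_1,\dots,t_{n-1},\omega)$ with $t_i=\Lambda^{-1}(p(v_i)-p(v_0))$ and $\omega=\Lambda^t\Lambda\in\Omega(d)$, where $\Omega(d)$ is the open cone of positive definite real symmetric $d\times d$ matrices. Two placements have the same parameter point exactly when they are equivalent under the isometry group $E(d)$, acting by $u\cdot(p,\pi)=(u\circ p,U\pi)$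 for $u(x)=Ux+t$, and every point of $(\mathbb{R}^d)^{n-1}\times\Omega(d)$ (an open subset of $\mathbb{R}^{dn+\binom{d}{2}}$) is the parameter point of some placement. The left action $\sigma(p,\pi)=(p\circ\sigma^{-1},\pi\circ C_{\sigma^{-1}})$ of $Aut(G,\Gamma)$ on placements induces an action on the parameter space $(\mathbb{R}^d)^{n-1}\times\Omega(d)$, denoted $x\mapsto A(\sigma)x$. For a subgroup $\Gamma\subset\Sigma\subset Aut(G,\Gamma)$, $$\mathcal{F}(\Sigma)=\{x\in(\mathbb{R}^d)^{n-1}\times\Omega(d)\ :\ A(\sigma)x=x\ \text{ for all }\sigma\in\Sigma\}.$$ An element $\sigma\in Aut(G,\Gamma)$ is a symmetry of the framework $(G,\Gamma,p,\pi)$ if there is an isometry $s\in E(d)$ with $s\circ p=p\circ\sigma$. A placement is said here to have crystallographic symmetry $\Sigma$ when every $\sigma\in\Sigma$ is a symmetry of $(G,\Gamma,p,\pi)$. *)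

theory Defs
  imports
    "HOL-Analysis.Analysis"
    "HOL-Algebra.Bij"
    "HOL-Algebra.Group_Action"
    "HOL-Algebra.Free_Abelian_Groups"
begin

section \<open>Periodic graphs\<close>

definition simple_graph :: "'v set \<Rightarrow> 'v set set \<Rightarrow> bool" where
  "simple_graph V E \<longleftrightarrow> (\<forall>e\<in>E. e \<subseteq> V \<and> card e = 2)"

definition connected_graph :: "'v set \<Rightarrow> 'v set set \<Rightarrow> bool" where
  "connected_graph V E \<longleftrightarrow> (\<forall>u\<in>V. \<forall>w\<in>V. (u, w) \<in> {(x, y). {x, y} \<in> E}\<^sup>*)"

definition graph_aut :: "'v set \<Rightarrow> 'v set set \<Rightarrow> ('v \<Rightarrow> 'v) monoid" where
  "graph_aut V E = (BijGroup V)\<lparr>carrier :=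
     {\<sigma> \<in> Bij V. \<forall>u\<in>V. \<forall>w\<in>V. {\<sigma> u, \<sigma> w} \<in> E \<longleftrightarrow> {u, w} \<in> E}\<rparr>"

abbreviation period_group :: "'v set \<Rightarrow> 'v set set \<Rightarrow> ('v \<Rightarrow> 'v) set \<Rightarrow> ('v \<Rightarrow> 'v) monoid" where
  "period_group V E \<Gamma> \<equiv> (graph_aut V E)\<lparr>carrier := \<Gamma>\<rparr>"

definition vertex_orbits :: "'v set \<Rightarrow> 'v set set \<Rightarrow> ('v \<Rightarrow> 'v) set \<Rightarrow> 'v set set" where
  "vertex_orbits V E \<Gamma> = orbits (period_group V E \<Gamma>) V (\<lambda>\<gamma>. \<gamma>)"

definition edge_orbits :: "'v set \<Rightarrow> 'v set set \<Rightarrow> ('v \<Rightarrow> 'v) set \<Rightarrow> 'v set set set" where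
  "edge_orbits V E \<Gamma> = orbits (period_group V E \<Gamma>) E (\<lambda>\<gamma> e. \<gamma> ` e)"

text \<open>The vertices and edges of the quotient multigraph are the orbits of \<open>\<Gamma>\<close> on \<open>V\<close> and
  on \<open>E\<close>.\<close>

definition periodic_graph :: "nat \<Rightarrow> 'v set \<Rightarrow> 'v set set \<Rightarrow> ('v \<Rightarrow> 'v) set \<Rightarrow> bool" where
  "periodic_graph d V E \<Gamma> \<longleftrightarrow>
     simple_graph V E \<and> infinite V \<and> connected_graph V E \<and>
     subgroup \<Gamma> (graph_aut V E) \<and>
     period_group V E \<Gamma> \<cong> free_Abelian_group {..<d} \<and>
     (\<forall>\<gamma>\<in>\<Gamma>. \<forall>x\<in>V. \<gamma> x = x \<longrightarrow> \<gamma> = \<one>\<^bsub>graph_aut V E\<^esub>) \<and>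
     finite (vertex_orbits V E \<Gamma>) \<and> finite (edge_orbits V E \<Gamma>)"

definition periodic_aut :: "'v set \<Rightarrow> 'v set set \<Rightarrow> ('v \<Rightarrow> 'v) set \<Rightarrow> ('v \<Rightarrow> 'v) set" where
  "periodic_aut V E \<Gamma> = normalizer (graph_aut V E) \<Gamma>"

definition conj_by :: "'v set \<Rightarrow> 'v set set \<Rightarrow> ('v \<Rightarrow> 'v) \<Rightarrow> ('v \<Rightarrow> 'v) \<Rightarrow> ('v \<Rightarrow> 'v)" where
  "conj_by V E \<sigma> \<gamma> = \<sigma> \<otimes>\<^bsub>graph_aut V E\<^esub> \<gamma> \<otimes>\<^bsub>graph_aut V E\<^esub> inv\<^bsub>graph_aut V E\<^esub> \<sigma>"


section \<open>Periodic placements\<close>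

text \<open>A translation of \<open>\<real>\<^sup>d\<close> is identified with its translation vector.\<close>

definition translation_group :: "(real ^ 'd) monoid" where
  "translation_group = \<lparr>carrier = UNIV, monoid.mult = (+), one = 0\<rparr>"

definition lattice_of_rank :: "nat \<Rightarrow> (real ^ 'd) set \<Rightarrow> bool" where
  "lattice_of_rank k L \<longleftrightarrow>
     (\<exists>B. finite B \<and> card B = k \<and> independent B \<and>
          L = range (\<lambda>c :: real ^ 'd \<Rightarrow> int. \<Sum>b\<in>B. of_int (c b) *\<^sub>R b))"

type_synonym ('v, 'd) placement = "('v \<Rightarrow> real ^ 'd) \<times> (('v \<Rightarrow> 'v) \<Rightarrow> real ^ 'd)"

definition periodic_placement ::
  "'v set \<Rightarrow> 'v set set \<Rightarrow> ('v \<Rightarrow> 'v) set \<Rightarrow> ('v, 'd::finite) placement \<Rightarrow> bool" where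
  "periodic_placement V E \<Gamma> = (\<lambda>(p, \<pi>).
     \<pi> \<in> hom (period_group V E \<Gamma>) translation_group \<and> inj_on \<pi> \<Gamma> \<and>
     lattice_of_rank CARD('d) (\<pi> ` \<Gamma>) \<and>
     (\<forall>\<gamma>\<in>\<Gamma>. \<forall>x\<in>V. p (\<gamma> x) = p x + \<pi> \<gamma>))"

definition euclidean_isometries :: "(real ^ 'd \<Rightarrow> real ^ 'd) set" where
  "euclidean_isometries = {s. \<exists>U t. orthogonal_matrix U \<and> s = (\<lambda>x. U *v x + t)}"

definition framework_symmetry ::
  "'v set \<Rightarrow> 'v set set \<Rightarrow> ('v \<Rightarrow> 'v) set \<Rightarrow> ('v, 'd::finite) placement \<Rightarrow> ('v \<Rightarrow> 'v) \<Rightarrow> bool" where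
  "framework_symmetry V E \<Gamma> = (\<lambda>(p, \<pi>) \<sigma>.
     \<sigma> \<in> periodic_aut V E \<Gamma> \<and>
     (\<exists>s\<in>euclidean_isometries. \<forall>x\<in>V. s (p x) = p (\<sigma> x)))"

definition crystallographic_symmetry ::
  "'v set \<Rightarrow> 'v set set \<Rightarrow> ('v \<Rightarrow> 'v) set \<Rightarrow> ('v \<Rightarrow> 'v) set \<Rightarrow> ('v, 'd::finite) placement \<Rightarrow> bool" where
  "crystallographic_symmetry V E \<Gamma> \<Sigma> P \<longleftrightarrow> (\<forall>\<sigma>\<in>\<Sigma>. framework_symmetry V E \<Gamma> P \<sigma>)"

definition placement_act ::
  "'v set \<Rightarrow> 'v set set \<Rightarrow> ('v \<Rightarrow> 'v) \<Rightarrow> ('v, 'd) placement \<Rightarrow> ('v, 'd) placement" where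
  "placement_act V E \<sigma> = (\<lambda>(p, \<pi>).
     (p \<circ> inv\<^bsub>graph_aut V E\<^esub> \<sigma>, \<pi> \<circ> conj_by V E (inv\<^bsub>graph_aut V E\<^esub> \<sigma>)))"


section \<open>Parameters\<close>

text \<open>The \<open>n\<close> vertex orbits are indexed by a finite type \<open>'n\<close>, with \<open>v i\<close> the representative
  of orbit \<open>i\<close>; the index \<open>i\<^sub>0\<close> singles out the base vertex. Since there is no index type with
  \<open>n - 1\<close> elements when \<open>n = 1\<close>, the factor \<open>(\<real>\<^sup>d)\<^bsup>n-1\<^esup>\<close> appears as the space of \<open>n\<close>-tuples
  whose coordinate at \<open>i\<^sub>0\<close> is \<open>0\<close>.\<close>

definition orbit_representatives ::
  "'v set \<Rightarrow> 'v set set \<Rightarrow> ('v \<Rightarrow> 'v) set \<Rightarrow> ('n::finite \<Rightarrow> 'v) \<Rightarrow> bool" where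
  "orbit_representatives V E \<Gamma> v \<longleftrightarrow>
     range v \<subseteq> V \<and>
     bij_betw (\<lambda>i. orbit (period_group V E \<Gamma>) (\<lambda>\<gamma>. \<gamma>) (v i)) UNIV (vertex_orbits V E \<Gamma>)"

type_synonym ('n, 'd) parameters = "(real ^ 'd ^ 'n) \<times> (real ^ 'd ^ 'd)"

definition positive_definite_cone :: "(real ^ 'd ^ 'd) set" where
  "positive_definite_cone =
     {\<omega>. transpose \<omega> = \<omega> \<and> (\<forall>x. x \<noteq> 0 \<longrightarrow> x \<bullet> (\<omega> *v x) > 0)}"

definition parameter_space :: "'n \<Rightarrow> ('n::finite, 'd::finite) parameters set" where
  "parameter_space i\<^sub>0 = {t. t $ i\<^sub>0 = 0} \<times> positive_definite_cone"

text \<open>The linear space of dimension \<open>d (n - 1) + d (d + 1) / 2 = d n + binom d 2\<close> in which the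
  parameter space is open.\<close>

definition parameter_ambient :: "'n \<Rightarrow> ('n::finite, 'd::finite) parameters set" where
  "parameter_ambient i\<^sub>0 = {t. t $ i\<^sub>0 = 0} \<times> {\<omega>. transpose \<omega> = \<omega>}"

text \<open>Here \<open>\<phi>\<close> is the chosen isomorphism from \<open>\<int>\<^sup>d\<close> onto \<open>\<Gamma>\<close>, and \<open>frag_of j\<close> is the \<open>j\<close>-th
  standard basis vector of \<open>\<int>\<^sup>d\<close>.\<close>

definition lattice_matrix ::
  "(('d \<Rightarrow>\<^sub>0 int) \<Rightarrow> 'v \<Rightarrow> 'v) \<Rightarrow> (('v \<Rightarrow> 'v) \<Rightarrow> real ^ 'd) \<Rightarrow> real ^ 'd ^ 'd" where
  "lattice_matrix \<phi> \<pi> = (\<chi> i j. \<pi> (\<phi> (frag_of j)) $ i)"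

definition parameter_point ::
  "(('d \<Rightarrow>\<^sub>0 int) \<Rightarrow> 'v \<Rightarrow> 'v) \<Rightarrow> ('n::finite \<Rightarrow> 'v) \<Rightarrow> 'n
     \<Rightarrow> ('v, 'd::finite) placement \<Rightarrow> ('n, 'd) parameters" where
  "parameter_point \<phi> v i\<^sub>0 = (\<lambda>(p, \<pi>).
     let \<Lambda> = lattice_matrix \<phi> \<pi>
     in (\<chi> i. matrix_inv \<Lambda> *v (p (v i) - p (v i\<^sub>0)), transpose \<Lambda> ** \<Lambda>))"

definition parameter_act ::
  "'v set \<Rightarrow> 'v set set \<Rightarrow> ('v \<Rightarrow> 'v) set \<Rightarrow> (('d \<Rightarrow>\<^sub>0 int) \<Rightarrow> 'v \<Rightarrow> 'v) \<Rightarrow> ('n::finite \<Rightarrow> 'v) \<Rightarrow> 'n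
     \<Rightarrow> ('v \<Rightarrow> 'v) \<Rightarrow> ('n, 'd::finite) parameters \<Rightarrow> ('n, 'd) parameters" where
  "parameter_act V E \<Gamma> \<phi> v i\<^sub>0 \<sigma> x =
     (THE y. \<exists>P. periodic_placement V E \<Gamma> P \<and> parameter_point \<phi> v i\<^sub>0 P = x \<and>
                 parameter_point \<phi> v i\<^sub>0 (placement_act V E \<sigma> P) = y)"

definition fixed_parameters ::
  "'v set \<Rightarrow> 'v set set \<Rightarrow> ('v \<Rightarrow> 'v) set \<Rightarrow> (('d \<Rightarrow>\<^sub>0 int) \<Rightarrow> 'v \<Rightarrow> 'v) \<Rightarrow> ('n::finite \<Rightarrow> 'v) \<Rightarrow> 'n
     \<Rightarrow> ('v \<Rightarrow> 'v) set \<Rightarrow> ('n, 'd::finite) parameters set" where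
  "fixed_parameters V E \<Gamma> \<phi> v i\<^sub>0 \<Sigma> =
     {x \<in> parameter_space i\<^sub>0. \<forall>\<sigma>\<in>\<Sigma>. parameter_act V E \<Gamma> \<phi> v i\<^sub>0 \<sigma> x = x}"

definition crystallographic_subgroups ::
  "'v set \<Rightarrow> 'v set set \<Rightarrow> ('v \<Rightarrow> 'v) set \<Rightarrow> ('v \<Rightarrow> 'v) set set" where
  "crystallographic_subgroups V E \<Gamma> =
     {\<Sigma>. subgroup \<Sigma> (graph_aut V E) \<and> \<Gamma> \<subseteq> \<Sigma> \<and> \<Sigma> \<subseteq> periodic_aut V E \<Gamma>}"

end

theory Submission
  imports Defs
begin

text \<open>
  In the basis of the period lattice, an automorphism \<open>\<sigma>\<close> normalizing \<open>\<Gamma>\<close> acts on parameters by an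
  explicit affine map, built from the integer matrix of conjugation by \<open>\<sigma>\<close> and from the orbits and
  lattice cells of the images of the representatives. A placement admits \<open>\<sigma>\<close> as a symmetry
  exactly when its parameter point is fixed by this map, so \<open>\<F>(\<Sigma>)\<close> is an affine section. There are
  only finitely many such maps: the graph is connected with finitely many edge orbits, so for given
  vertices \<open>x\<close> and \<open>y\<close> the lattice displacement from \<open>\<sigma> x\<close> to \<open>\<sigma> y\<close> takes finitely many values.
  This makes the family of sections finite, and makes every orbit of \<open>\<Sigma>\<close> in the convex parameter
  space finite, so that its barycentre is a point of \<open>\<F>(\<Sigma>)\<close>.
\<close>

section \<open>Matrices and positive definite forms\<close>

lemma matrix_inv_left: "invertible A \<Longrightarrow> matrix_inv A ** A = mat 1"
  and matrix_inv_right: "invertible A \<Longrightarrow> A ** matrix_inv A = mat 1"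
  for A :: "real ^ 'n ^ 'n"
  unfolding invertible_def matrix_inv_def by (rule someI2_ex; blast)+

lemma matrix_inv_unique: "A ** B = mat 1 \<Longrightarrow> matrix_inv A = B"
  for A B :: "real ^ 'n ^ 'n"
  by (metis invertible_right_inverse matrix_inv_left matrix_mul_assoc matrix_mul_lid matrix_mul_rid)

lemma matrix_inv_mult:
  fixes A B :: "real ^ 'n ^ 'n"
  assumes "invertible A" "invertible B"
  shows "matrix_inv (A ** B) = matrix_inv B ** matrix_inv A"
  using assms
  by (intro matrix_inv_unique) (metis matrix_inv_right matrix_mul_assoc matrix_mul_rid)

lemma matrix_inv_vector:
  fixes A :: "real ^ 'n ^ 'n"
  assumes "invertible A"
  shows "matrix_inv A *v (A *v x) = x" "A *v (matrix_inv A *v x) = x"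
  using assms by (simp_all add: matrix_vector_mul_assoc matrix_inv_left matrix_inv_right)

lemma positive_definite_coneI:
  "transpose \<omega> = \<omega> \<Longrightarrow> (\<And>x. x \<noteq> 0 \<Longrightarrow> x \<bullet> (\<omega> *v x) > 0) \<Longrightarrow> \<omega> \<in> positive_definite_cone"
  by (simp add: positive_definite_cone_def)

lemma congruence_positive_definite:
  fixes \<omega> M :: "real ^ 'd ^ 'd"
  assumes "\<omega> \<in> positive_definite_cone" "invertible M"
  shows "transpose M ** \<omega> ** M \<in> positive_definite_cone"
proof (rule positive_definite_coneI)
  show "transpose (transpose M ** \<omega> ** M) = transpose M ** \<omega> ** M"
    using assms by (simp add: positive_definite_cone_def matrix_transpose_mul matrix_mul_assoc)
  fix x :: "real ^ 'd" assume "x \<noteq> 0"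
  then have "M *v x \<noteq> 0"
    by (metis assms(2) matrix_inv_left matrix_vector_mul_assoc matrix_vector_mul_lid matrix_vector_mult_0_right)
  then have "(M *v x) \<bullet> (\<omega> *v (M *v x)) > 0"
    using assms by (simp add: positive_definite_cone_def)
  also have "(M *v x) \<bullet> (\<omega> *v (M *v x)) = x \<bullet> ((transpose M ** \<omega> ** M) *v x)"
    by (metis dot_lmul_matrix inner_commute matrix_mul_assoc matrix_vector_mul_assoc transpose_matrix_vector)
  finally show "x \<bullet> ((transpose M ** \<omega> ** M) *v x) > 0" .
qed

lemma mat_1_positive_definite: "mat 1 \<in> positive_definite_cone"
  by (simp add: positive_definite_cone_def)

lemma gram_positive_definite:
  fixes \<Lambda> :: "real ^ 'd ^ 'd"
  shows "invertible \<Lambda> \<Longrightarrow> transpose \<Lambda> ** \<Lambda> \<in> positive_definite_cone"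
  using congruence_positive_definite[OF mat_1_positive_definite, of \<Lambda>] by simp

text \<open>Gram-Schmidt for the form \<open>\<omega>\<close>: at most \<open>k\<close> vectors
  \<open>\<omega> *v b\<close> span a proper subspace, so some nonzero \<open>x\<close> is
  Euclidean-orthogonal to all of them. This is orthogonality to \<open>B\<close> for the form, and
  positivity allows \<open>x\<close> to be normalised.\<close>

lemma positive_definite_orthonormal_set:
  fixes \<omega> :: "real ^ 'd ^ 'd"
  assumes \<omega>: "\<omega> \<in> positive_definite_cone" and "k \<le> CARD('d)"
  shows "\<exists>B. finite B \<and> card B = k \<and> (\<forall>x\<in>B. \<forall>y\<in>B. x \<bullet> (\<omega> *v y) = (if x = y then 1 else 0))"
  using assms(2)
proof (induction k)
  case 0
  show ?case by (rule exI[of _ "{}"]) simp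
next
  case (Suc k)
  then obtain B where B: "finite B" "card B = k"
    "\<And>x y. x \<in> B \<Longrightarrow> y \<in> B \<Longrightarrow> x \<bullet> (\<omega> *v y) = (if x = y then 1 else 0)"
    by force
  have "dim ((*v) \<omega> ` B) \<le> k"
    using B by (metis card_image_le dim_le_card' finite_imageI order_trans)
  then obtain x where x: "x \<noteq> 0" "\<And>y. y \<in> span ((*v) \<omega> ` B) \<Longrightarrow> orthogonal x y"
    using orthogonal_to_subspace_exists[of "(*v) \<omega> ` B"] Suc.prems by auto
  have sym: "a \<bullet> (\<omega> *v b) = b \<bullet> (\<omega> *v a)" for a b
    using \<omega> unfolding positive_definite_cone_def
    by (metis (mono_tags, lifting) dot_lmul_matrix inner_commute mem_Collect_eq transpose_matrix_vector)
  have xB: "x \<bullet> (\<omega> *v b) = 0" if "b \<in> B" for b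
    using x(2)[of "\<omega> *v b"] that by (simp add: span_base orthogonal_def)
  define c where "c = x \<bullet> (\<omega> *v x)"
  have c: "c > 0" using \<omega> x(1) by (simp add: c_def positive_definite_cone_def)
  define y where "y = (1 / sqrt c) *\<^sub>R x"
  have yy: "y \<bullet> (\<omega> *v y) = 1"
    using c by (simp add: y_def matrix_vector_mult_scaleR flip: c_def)
  have yB: "y \<bullet> (\<omega> *v b) = 0" "b \<bullet> (\<omega> *v y) = 0" if "b \<in> B" for b
    using xB[OF that] sym[of b y] by (simp_all add: y_def)
  have "y \<notin> B" using yy yB by force
  then show ?case
    using B yy yB by (intro exI[of _ "insert y B"]) auto
qed

text \<open>Every Gram matrix must come from an actual lattice basis. If the columns of
  \<open>Q\<close> are orthonormal for \<open>\<omega>\<close>, then \<open>Q\<close> has inverse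
  \<open>transpose Q ** \<omega>\<close>, and this inverse serves as
  \<open>\<Lambda>\<close>.\<close>

lemma positive_definite_factorization:
  fixes \<omega> :: "real ^ 'd ^ 'd"
  assumes "\<omega> \<in> positive_definite_cone"
  obtains \<Lambda> :: "real ^ 'd ^ 'd" where "invertible \<Lambda>" "transpose \<Lambda> ** \<Lambda> = \<omega>"
proof -
  obtain B where B: "finite B" "card B = CARD('d)"
    "\<And>x y. x \<in> B \<Longrightarrow> y \<in> B \<Longrightarrow> x \<bullet> (\<omega> *v y) = (if x = y then 1 else 0)"
    using positive_definite_orthonormal_set[OF assms, of "CARD('d)"] by blast
  obtain g :: "'d \<Rightarrow> real ^ 'd" where g: "bij_betw g UNIV B"
    using B(1,2) finite_same_card_bij[of "UNIV :: 'd set" B] by auto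
  have gB: "g i \<in> B" and gi: "g i = g j \<longleftrightarrow> i = j" for i j
    using g by (auto simp: bij_betw_def inj_eq)
  define Q :: "real ^ 'd ^ 'd" where "Q = (\<chi> i j. g j $ i)"
  have "transpose Q ** \<omega> ** Q = mat 1"
  proof -
    have "(transpose Q ** (\<omega> ** Q)) $ i $ j = g i \<bullet> (\<omega> *v g j)" for i j
      by (simp add: Q_def matrix_matrix_mult_def matrix_vector_mult_def transpose_def inner_vec_def)
    then have "(transpose Q ** (\<omega> ** Q)) $ i $ j = mat 1 $ i $ j" for i j
      by (simp add: B(3)[OF gB gB] gi mat_def)
    then show ?thesis
      by (metis matrix_mul_assoc vec_eq_iff)
  qed
  moreover from this have "Q ** (transpose Q ** \<omega>) = mat 1"
    by (simp add: matrix_left_right_inverse)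
  moreover have "transpose \<omega> = \<omega>"
    using assms by (simp add: positive_definite_cone_def)
  ultimately show thesis
    by (intro that[of "transpose Q ** \<omega>"])
       (auto simp: invertible_def matrix_transpose_mul simp flip: matrix_mul_assoc)
qed

lemma convex_positive_definite_cone: "convex (positive_definite_cone :: (real ^ 'd ^ 'd) set)"
proof (rule convexI)
  fix x y :: "real ^ 'd ^ 'd" and u w :: real
  assume *: "x \<in> positive_definite_cone" "y \<in> positive_definite_cone" "0 \<le> u" "0 \<le> w" "u + w = 1"
  show "u *\<^sub>R x + w *\<^sub>R y \<in> positive_definite_cone"
  proof (rule positive_definite_coneI)
    show "transpose (u *\<^sub>R x + w *\<^sub>R y) = u *\<^sub>R x + w *\<^sub>R y"
      using * by (auto simp: positive_definite_cone_def vec_eq_iff transpose_def)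
    fix z :: "real ^ 'd" assume "z \<noteq> 0"
    then have pos: "z \<bullet> (x *v z) > 0" "z \<bullet> (y *v z) > 0"
      using * by (auto simp: positive_definite_cone_def)
    have "z \<bullet> ((u *\<^sub>R x + w *\<^sub>R y) *v z) = u * (z \<bullet> (x *v z)) + w * (z \<bullet> (y *v z))"
      by (simp add: matrix_vector_mult_add_rdistrib scaleR_matrix_vector_assoc[symmetric] inner_add_right)
    \<comment> \<open>One of the weights may vanish: if \<open>u = 0\<close> then
      \<open>w = 1\<close>; otherwise the first summand is positive and the second
      nonnegative.\<close>
    also have "\<dots> > 0"
      using pos * by (cases "u = 0") (auto intro: add_pos_nonneg)
    finally show "z \<bullet> ((u *\<^sub>R x + w *\<^sub>R y) *v z) > 0" .
  qed
qed

lemma convex_parameter_space: "convex (parameter_space i\<^sub>0 :: ('n::finite, 'd::finite) parameters set)"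
proof -
  have "convex {t :: real ^ 'd ^ 'n. t $ i\<^sub>0 = 0}"
    by (rule convexI) simp
  then show ?thesis
    unfolding parameter_space_def by (intro convex_Times convex_positive_definite_cone)
qed

lemma affine_parameter_ambient: "affine (parameter_ambient i\<^sub>0 :: ('n::finite, 'd::finite) parameters set)"
  by (auto simp: affine_def parameter_ambient_def transpose_def vec_eq_iff)

lemma parameter_space_subset_ambient: "parameter_space i\<^sub>0 \<subseteq> parameter_ambient i\<^sub>0"
  by (auto simp: parameter_space_def parameter_ambient_def positive_definite_cone_def)

section \<open>Integer vectors and lattices\<close>

definition int_vec :: "('d::finite \<Rightarrow>\<^sub>0 int) \<Rightarrow> real ^ 'd" where
  "int_vec z = (\<chi> j. of_int (Poly_Mapping.lookup z j))"

lemma int_vec_simps [simp]: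
  "int_vec 0 = 0" "int_vec (a + b) = int_vec a + int_vec b" "int_vec (a - b) = int_vec a - int_vec b"
  "int_vec (frag_of j) = axis j 1"
  by (auto simp: int_vec_def vec_eq_iff lookup_add lookup_minus axis_def)

lemma inj_int_vec: "inj int_vec"
  by (auto simp: inj_def int_vec_def vec_eq_iff intro: poly_mapping_eqI)

text \<open>Over a finite index type every function has finite support, so
  \<open>Abs_poly_mapping\<close> loses nothing.\<close>

lemma int_vec_surj: "\<exists>z. int_vec z = (\<chi> j. of_int (c j))"
proof -
  have "Poly_Mapping.lookup (Abs_poly_mapping c) = c"
    by (simp add: Abs_poly_mapping_inverse)
  then show ?thesis
    by (intro exI[of _ "Abs_poly_mapping c"]) (simp add: int_vec_def)
qed

lemma matrix_vector_axis: "(A :: real ^ 'n ^ 'm) *v axis j 1 = column j A"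
  by (simp add: matrix_vector_mul_component column_def vec_eq_iff inner_axis)

text \<open>An additive map on the free Abelian group is fixed by its values on the generators.
  These are the columns of the matrix, so the map extends to a real linear one.\<close>

lemma int_vec_hom:
  fixes h :: "('d::finite \<Rightarrow>\<^sub>0 int) \<Rightarrow> real ^ 'm"
  assumes add: "\<And>a b. h (a + b) = h a + h b"
  shows "h z = (\<chi> i j. h (frag_of j) $ i) *v int_vec z"
proof -
  have diff: "h (a - b) = h a - h b" for a b
    using add[of "a - b" b] by simp
  have "h 0 = 0" using diff[of 0 0] by simp
  have "Poly_Mapping.keys z \<subseteq> UNIV" by simp
  then show ?thesis
  proof (induction z rule: frag_induction)
    case zero then show ?case using \<open>h 0 = 0\<close> by simp
  next
    case (one x) then show ?case by (simp add: matrix_vector_axis column_def vec_eq_iff)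
  next
    case (diff a b) then show ?case by (simp add: \<open>h (a - b) = h a - h b\<close> matrix_vector_mult_diff_distrib)
  qed
qed

lemma matrix_eq_on_axes: "(\<And>j. A *v axis j 1 = B *v axis j 1) \<Longrightarrow> A = B"
  for A B :: "real ^ 'n ^ 'm"
  by (simp add: matrix_vector_axis column_def vec_eq_iff)

text \<open>The columns of \<open>\<Lambda>\<close> form the required basis. The work lies in
  passing between coefficients indexed by basis vectors and coefficients indexed by
  \<open>'d\<close>.\<close>

lemma lattice_of_rank_columns:
  fixes \<Lambda> :: "real ^ 'd ^ 'd"
  assumes "invertible \<Lambda>"
  shows "lattice_of_rank CARD('d) (range (\<lambda>z. \<Lambda> *v int_vec z))"
proof -
  define g where "g j = \<Lambda> *v axis j 1" for j
  have inj\<Lambda>: "inj ((*v) \<Lambda>)" using assms by (metis injI matrix_inv_vector(1))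
  have inj: "inj g"
    by (rule injI) (metis g_def inj\<Lambda> injD axis_eq_axis zero_neq_one)
  have g_column: "g j = column j \<Lambda>" for j by (simp add: g_def matrix_vector_axis)
  have sum: "(\<Sum>b\<in>range g. of_int (c b) *\<^sub>R b) = \<Lambda> *v (\<chi> j. of_int (c (g j)))" for c
    by (simp add: sum.reindex[OF inj])
      (simp add: matrix_mult_sum g_column scalar_mult_eq_scaleR)
  have "independent (range (\<lambda>j. axis j (1::real)) :: (real ^ 'd) set)"
    by (rule independent_mono[OF independent_Basis]) auto
  then have "independent ((*v) \<Lambda> ` range (\<lambda>j. axis j (1::real)))"
    by (intro linear_independent_injective_image inj_on_subset[OF inj\<Lambda>]) simp_all
  then have "independent (range g)" by (simp add: g_def image_image)
  moreover have "range (\<lambda>z. \<Lambda> *v int_vec z) = range (\<lambda>c. \<Sum>b\<in>range g. of_int (c b) *\<^sub>R b)"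
  proof safe
    fix z
    \<comment> \<open>The coefficient at \<open>b\<close> is the entry of \<open>z\<close> at the
      index of the column \<open>b\<close>, well defined because distinct indices give distinct
      columns.\<close>
    have "\<Lambda> *v int_vec z = (\<Sum>b\<in>range g. of_int (Poly_Mapping.lookup z (inv_into UNIV g b)) *\<^sub>R b)"
      unfolding sum by (simp add: int_vec_def inj)
    then show "\<Lambda> *v int_vec z \<in> range (\<lambda>c. \<Sum>b\<in>range g. of_int (c b) *\<^sub>R b)"
      by (rule image_eqI[where x = "\<lambda>b. Poly_Mapping.lookup z (inv_into UNIV g b)", OF _ UNIV_I])
  next
    fix c :: "real ^ 'd \<Rightarrow> int"
    show "(\<Sum>b\<in>range g. of_int (c b) *\<^sub>R b) \<in> range (\<lambda>z. \<Lambda> *v int_vec z)"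
      unfolding sum using int_vec_surj[of "\<lambda>j. c (g j)"] by (metis rangeI)
  qed
  ultimately show ?thesis
    unfolding lattice_of_rank_def
    by (intro exI[of _ "range g"]) (simp add: card_image[OF inj])
qed

section \<open>Automorphisms of a periodic graph\<close>

lemma mult_graph_aut:
  "\<sigma> \<in> carrier (graph_aut V E) \<Longrightarrow> \<tau> \<in> carrier (graph_aut V E) \<Longrightarrow>
    \<sigma> \<otimes>\<^bsub>graph_aut V E\<^esub> \<tau> = compose V \<sigma> \<tau>"
  by (simp add: graph_aut_def BijGroup_def)

lemma graph_aut_closed: "\<sigma> \<in> carrier (graph_aut V E) \<Longrightarrow> x \<in> V \<Longrightarrow> \<sigma> x \<in> V"
  by (auto simp: graph_aut_def Bij_def bij_betw_def)

lemma graph_aut_edge: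
  "\<sigma> \<in> carrier (graph_aut V E) \<Longrightarrow> x \<in> V \<Longrightarrow> y \<in> V \<Longrightarrow> {\<sigma> x, \<sigma> y} \<in> E \<longleftrightarrow> {x, y} \<in> E"
  by (auto simp: graph_aut_def)

text \<open>The edge condition is an equivalence, so it passes to inverses and cuts out a subgroup
  of \<open>BijGroup V\<close>.\<close>

lemma group_graph_aut: "group (graph_aut V E)"
proof -
  let ?A = "{\<sigma> \<in> Bij V. \<forall>u\<in>V. \<forall>w\<in>V. {\<sigma> u, \<sigma> w} \<in> E \<longleftrightarrow> {u, w} \<in> E}"
  have inv: "restrict (inv_into V \<sigma>) V \<in> ?A" if "\<sigma> \<in> ?A" for \<sigma>
  proof -
    have \<sigma>: "bij_betw \<sigma> V V" using that by (simp add: Bij_def)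
    have "{inv_into V \<sigma> u, inv_into V \<sigma> w} \<in> E \<longleftrightarrow> {u, w} \<in> E" if "u \<in> V" "w \<in> V" for u w
    proof -
      have "inv_into V \<sigma> u \<in> V" "inv_into V \<sigma> w \<in> V" 
        "\<sigma> (inv_into V \<sigma> u) = u" "\<sigma> (inv_into V \<sigma> w) = w"
        using \<sigma> that by (auto simp: bij_betw_def inv_into_into f_inv_into_f)
      then show ?thesis
        using \<open>\<sigma> \<in> ?A\<close> by force
    qed
    then show ?thesis
      using that by (simp add: restrict_inv_into_Bij)
  qed
  have "subgroup ?A (BijGroup V)"
  proof (rule group.subgroupI[OF group_BijGroup])
    show "?A \<subseteq> carrier (BijGroup V)" by (auto simp: BijGroup_def)
    show "?A \<noteq> {}" using id_Bij[of V] by (auto intro!: exI[of _ "\<lambda>x\<in>V. x"])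
    show "inv\<^bsub>BijGroup V\<^esub> \<sigma> \<in> ?A" if "\<sigma> \<in> ?A" for \<sigma>
      using inv[OF that] inv_BijGroup[of \<sigma> V] that by simp
    show "\<sigma> \<otimes>\<^bsub>BijGroup V\<^esub> \<tau> \<in> ?A" if "\<sigma> \<in> ?A" "\<tau> \<in> ?A" for \<sigma> \<tau>
    proof -
      have "\<tau> x \<in> V" if "x \<in> V" for x
        using \<open>\<tau> \<in> ?A\<close> that by (auto simp: Bij_def bij_betw_def)
      then show ?thesis
        using that by (simp add: BijGroup_def compose_Bij compose_eq)
    qed
  qed
  then show ?thesis
    unfolding graph_aut_def by (rule group.subgroup_imp_group[OF group_BijGroup])
qed

locale periodic_graph_coordinates =
  fixes V :: "'v set" and E :: "'v set set" and \<Gamma> :: "('v \<Rightarrow> 'v) set"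
    and \<phi> :: "('d::finite \<Rightarrow>\<^sub>0 int) \<Rightarrow> 'v \<Rightarrow> 'v"
    and v :: "'n::finite \<Rightarrow> 'v" and i\<^sub>0 :: 'n
  assumes periodic: "periodic_graph CARD('d) V E \<Gamma>"
    and \<phi>_iso: "\<phi> \<in> iso (free_Abelian_group (UNIV :: 'd set)) (period_group V E \<Gamma>)"
    and representatives: "orbit_representatives V E \<Gamma> v"
begin

abbreviation "G \<equiv> graph_aut V E"
abbreviation "N \<equiv> periodic_aut V E \<Gamma>"

sublocale group G by (rule group_graph_aut)

lemma subgroup_\<Gamma>: "subgroup \<Gamma> G"
  using periodic by (simp add: periodic_graph_def)

lemma \<Gamma>_carrier: "\<gamma> \<in> \<Gamma> \<Longrightarrow> \<gamma> \<in> carrier G"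
  using subgroup.mem_carrier[OF subgroup_\<Gamma>] .

lemma subgroup_N: "subgroup N G"
  unfolding periodic_aut_def by (rule normalizer_imp_subgroup[OF subgroup.subset[OF subgroup_\<Gamma>]])

lemma N_carrier: "\<sigma> \<in> N \<Longrightarrow> \<sigma> \<in> carrier G"
  using subgroup.mem_carrier[OF subgroup_N] .

lemma conj_by_closed:
  assumes "\<sigma> \<in> N" "\<gamma> \<in> \<Gamma>"
  shows "conj_by V E \<sigma> \<gamma> \<in> \<Gamma>"
proof -
  \<comment> \<open>The normalizer is defined as the stabilizer of \<open>\<Gamma>\<close> under
    conjugation of subsets, so membership is literally this equation of sets.\<close>
  have "\<sigma> <#\<^bsub>G\<^esub> \<Gamma> #>\<^bsub>G\<^esub> inv\<^bsub>G\<^esub> \<sigma> = \<Gamma>"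
    using assms(1) subgroup.subset[OF subgroup_\<Gamma>]
    by (simp add: periodic_aut_def normalizer_def stabilizer_def)
  moreover have "conj_by V E \<sigma> \<gamma> \<in> \<sigma> <#\<^bsub>G\<^esub> \<Gamma> #>\<^bsub>G\<^esub> inv\<^bsub>G\<^esub> \<sigma>"
    using assms(2) by (auto simp: conj_by_def l_coset_def r_coset_def)
  ultimately show ?thesis by simp
qed

lemma mult_apply: "\<sigma> \<in> carrier G \<Longrightarrow> \<tau> \<in> carrier G \<Longrightarrow> x \<in> V \<Longrightarrow> (\<sigma> \<otimes>\<^bsub>G\<^esub> \<tau>) x = \<sigma> (\<tau> x)"
  by (simp add: mult_graph_aut compose_eq)

lemma one_apply: "x \<in> V \<Longrightarrow> \<one>\<^bsub>G\<^esub> x = x"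
  by (simp add: graph_aut_def BijGroup_def)

lemma inv_apply:
  "\<sigma> \<in> carrier G \<Longrightarrow> x \<in> V \<Longrightarrow> \<sigma> ((inv\<^bsub>G\<^esub> \<sigma>) x) = x"
  "\<sigma> \<in> carrier G \<Longrightarrow> x \<in> V \<Longrightarrow> (inv\<^bsub>G\<^esub> \<sigma>) (\<sigma> x) = x"
  by (simp_all add: one_apply flip: mult_apply)

lemma conj_by_apply:
  "\<sigma> \<in> N \<Longrightarrow> \<gamma> \<in> \<Gamma> \<Longrightarrow> x \<in> V \<Longrightarrow> conj_by V E \<sigma> \<gamma> (\<sigma> x) = \<sigma> (\<gamma> x)"
  by (simp add: conj_by_def mult_apply N_carrier \<Gamma>_carrier graph_aut_closed[of _ V E] inv_apply)

lemma conj_by_mult: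
  assumes "\<sigma> \<in> N" "\<gamma> \<in> \<Gamma>" "\<delta> \<in> \<Gamma>"
  shows "conj_by V E \<sigma> (\<gamma> \<otimes>\<^bsub>G\<^esub> \<delta>) = conj_by V E \<sigma> \<gamma> \<otimes>\<^bsub>G\<^esub> conj_by V E \<sigma> \<delta>"
  using assms by (simp add: conj_by_def N_carrier \<Gamma>_carrier m_assoc inv_solve_left)

lemma free_action: "\<gamma> \<in> \<Gamma> \<Longrightarrow> x \<in> V \<Longrightarrow> \<gamma> x = x \<Longrightarrow> \<gamma> = \<one>\<^bsub>G\<^esub>"
  using periodic unfolding periodic_graph_def by blast

text \<open>Freeness is applied to the quotient of \<open>\<gamma>\<close> by
  \<open>\<delta>\<close>, which fixes \<open>x\<close>.\<close>

lemma free_action_eq: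
  assumes "\<gamma> \<in> \<Gamma>" "\<delta> \<in> \<Gamma>" "x \<in> V" "\<gamma> x = \<delta> x"
  shows "\<gamma> = \<delta>"
proof -
  have eq: "inv\<^bsub>G\<^esub> \<delta> \<otimes>\<^bsub>G\<^esub> \<gamma> = \<one>\<^bsub>G\<^esub>"
    using assms subgroup_\<Gamma>
    by (intro free_action[of _ x])
      (auto simp: mult_apply \<Gamma>_carrier inv_apply subgroup.m_closed subgroup.m_inv_closed)
  show ?thesis
    using inv_equality[OF eq] assms(1,2) by (metis \<Gamma>_carrier inv_closed inv_inv)
qed

section \<open>Integer coordinates on the period group and the matrix of conjugation\<close>

lemma \<phi>_bij: "bij_betw \<phi> UNIV \<Gamma>"
proof -
  have "carrier (free_Abelian_group (UNIV :: 'd set)) = UNIV" by auto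
  then show ?thesis using \<phi>_iso by (simp add: iso_def)
qed

lemma \<phi>_mem [simp]: "\<phi> z \<in> \<Gamma>"
  using \<phi>_bij by (auto simp: bij_betw_def)

lemma \<phi>_add: "\<phi> (a + b) = \<phi> a \<otimes>\<^bsub>G\<^esub> \<phi> b"
  using \<phi>_iso by (auto simp: iso_def hom_def)

text \<open>The inverse of \<open>\<phi>\<close>, with values read as real vectors so that real
  matrices act on them.\<close>

definition coord :: "('v \<Rightarrow> 'v) \<Rightarrow> real ^ 'd" where
  "coord \<gamma> = int_vec (inv_into UNIV \<phi> \<gamma>)"

lemma coord_\<phi> [simp]: "coord (\<phi> z) = int_vec z"
  using \<phi>_bij by (simp add: coord_def bij_betw_def)

lemma \<Gamma>_cases: assumes "\<gamma> \<in> \<Gamma>" obtains z where "\<gamma> = \<phi> z"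
  using \<phi>_bij assms by (auto simp: bij_betw_def)

lemma coord_mult: "\<gamma> \<in> \<Gamma> \<Longrightarrow> \<delta> \<in> \<Gamma> \<Longrightarrow> coord (\<gamma> \<otimes>\<^bsub>G\<^esub> \<delta>) = coord \<gamma> + coord \<delta>"
  by (metis \<Gamma>_cases \<phi>_add coord_\<phi> int_vec_simps(2))

lemma coord_inj: "inj_on coord \<Gamma>"
  by (rule inj_onI) (metis \<Gamma>_cases coord_\<phi> inj_int_vec injD)

lemma coord_one: "coord \<one>\<^bsub>G\<^esub> = 0"
  using coord_mult[of "\<one>\<^bsub>G\<^esub>" "\<one>\<^bsub>G\<^esub>"] subgroup.one_closed[OF subgroup_\<Gamma>] by simp

text \<open>Besides the translation map \<open>\<pi>\<close> of a placement, this also serves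
  conjugation by an automorphism, read in coordinates.\<close>

lemma hom_\<Gamma>_linear:
  fixes h :: "('v \<Rightarrow> 'v) \<Rightarrow> real ^ 'd"
  assumes "\<And>\<gamma> \<delta>. \<gamma> \<in> \<Gamma> \<Longrightarrow> \<delta> \<in> \<Gamma> \<Longrightarrow> h (\<gamma> \<otimes>\<^bsub>G\<^esub> \<delta>) = h \<gamma> + h \<delta>" "\<gamma> \<in> \<Gamma>"
  shows "h \<gamma> = lattice_matrix \<phi> h *v coord \<gamma>"
proof -
  obtain z where z: "\<gamma> = \<phi> z" using \<Gamma>_cases[OF assms(2)] .
  show ?thesis
    using int_vec_hom[of "h \<circ> \<phi>" z] assms(1) by (simp add: z \<phi>_add lattice_matrix_def)
qed

definition conj_matrix :: "('v \<Rightarrow> 'v) \<Rightarrow> real ^ 'd ^ 'd" where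
  "conj_matrix \<rho> = lattice_matrix \<phi> (\<lambda>\<gamma>. coord (conj_by V E \<rho> \<gamma>))"

lemma coord_conj_by: "\<rho> \<in> N \<Longrightarrow> \<gamma> \<in> \<Gamma> \<Longrightarrow> coord (conj_by V E \<rho> \<gamma>) = conj_matrix \<rho> *v coord \<gamma>"
  unfolding conj_matrix_def
  by (rule hom_\<Gamma>_linear[of "\<lambda>\<gamma>. coord (conj_by V E \<rho> \<gamma>)"])
     (simp_all add: conj_by_mult coord_mult conj_by_closed)

text \<open>The coordinates of the generators \<open>\<phi> (frag_of j)\<close> are the standard
  basis vectors.\<close>

lemma matrix_eq_on_\<Gamma>:
  fixes A B :: "real ^ 'd ^ 'm"
  assumes "\<And>\<gamma>. \<gamma> \<in> \<Gamma> \<Longrightarrow> A *v coord \<gamma> = B *v coord \<gamma>"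
  shows "A = B"
proof (rule matrix_eq_on_axes)
  show "A *v axis j 1 = B *v axis j 1" for j
    using assms[of "\<phi> (frag_of j)"] by simp
qed

lemma conj_matrix_mult:
  assumes "\<rho> \<in> N" "\<tau> \<in> N"
  shows "conj_matrix (\<rho> \<otimes>\<^bsub>G\<^esub> \<tau>) = conj_matrix \<rho> ** conj_matrix \<tau>"
proof (rule matrix_eq_on_\<Gamma>)
  fix \<gamma> assume \<gamma>: "\<gamma> \<in> \<Gamma>"
  have "conj_by V E (\<rho> \<otimes>\<^bsub>G\<^esub> \<tau>) \<gamma> = conj_by V E \<rho> (conj_by V E \<tau> \<gamma>)"
    using assms \<gamma> by (simp add: conj_by_def N_carrier \<Gamma>_carrier inv_mult_group m_assoc)
  then show "conj_matrix (\<rho> \<otimes>\<^bsub>G\<^esub> \<tau>) *v coord \<gamma> = conj_matrix \<rho> ** conj_matrix \<tau> *v coord \<gamma>"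
    using assms \<gamma>
    by (simp add: conj_by_closed subgroup.m_closed[OF subgroup_N] 
      flip: coord_conj_by matrix_vector_mul_assoc)
qed

lemma conj_matrix_one: "conj_matrix \<one>\<^bsub>G\<^esub> = mat 1"
proof (rule matrix_eq_on_\<Gamma>)
  fix \<gamma> assume \<gamma>: "\<gamma> \<in> \<Gamma>"
  have "conj_by V E \<one>\<^bsub>G\<^esub> \<gamma> = \<gamma>"
    using \<gamma> by (simp add: conj_by_def \<Gamma>_carrier)
  then show "conj_matrix \<one>\<^bsub>G\<^esub> *v coord \<gamma> = mat 1 *v coord \<gamma>"
    using \<gamma> by (simp add: subgroup.one_closed[OF subgroup_N] flip: coord_conj_by)
qed

lemma invertible_conj_matrix:
  assumes "\<rho> \<in> N" shows "invertible (conj_matrix \<rho>)"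
proof -
  have "conj_matrix (inv\<^bsub>G\<^esub> \<rho>) ** conj_matrix \<rho> = mat 1"
    using assms by (simp add: N_carrier conj_matrix_one subgroup.m_inv_closed[OF subgroup_N] flip: conj_matrix_mult)
  then show ?thesis by (auto simp: invertible_left_inverse)
qed

section \<open>Vertex orbits, representatives and lattice cells\<close>

lemma representative_mem: "v i \<in> V"
  using representatives by (auto simp: orbit_representatives_def)

lemma orbit_\<Gamma>: "orbit (period_group V E \<Gamma>) (\<lambda>\<gamma>. \<gamma>) x = {\<gamma> x | \<gamma>. \<gamma> \<in> \<Gamma>}"
  by (simp add: orbit_def)

lemma vertex_cases:
  assumes "x \<in> V"
  obtains i \<gamma> where "\<gamma> \<in> \<Gamma>" "x = \<gamma> (v i)"
proof -
  have "orbit (period_group V E \<Gamma>) (\<lambda>\<gamma>. \<gamma>) x \<in> vertex_orbits V E \<Gamma>"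
    using assms by (auto simp: vertex_orbits_def orbits_def)
  then obtain i where "orbit (period_group V E \<Gamma>) (\<lambda>\<gamma>. \<gamma>) x = orbit (period_group V E \<Gamma>) (\<lambda>\<gamma>. \<gamma>) (v i)"
    using representatives unfolding orbit_representatives_def bij_betw_def by blast
  moreover have "x \<in> orbit (period_group V E \<Gamma>) (\<lambda>\<gamma>. \<gamma>) x"
    unfolding orbit_\<Gamma> mem_Collect_eq
    by (rule exI[of _ "\<one>\<^bsub>G\<^esub>"]) (simp add: one_apply[OF assms] subgroup.one_closed[OF subgroup_\<Gamma>])
  ultimately show thesis using that by (auto simp: orbit_\<Gamma>)
qed

lemma representative_unique:
  assumes "\<gamma> \<in> \<Gamma>" "\<delta> \<in> \<Gamma>" "\<gamma> (v i) = \<delta> (v j)"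
  shows "i = j" "\<gamma> = \<delta>"
proof -
  let ?o = "\<lambda>i. {\<gamma> (v i) | \<gamma>. \<gamma> \<in> \<Gamma>}"
  \<comment> \<open>Stated for arbitrary indices because it is used in both directions to obtain
    equality of the two orbits.\<close>
  have sub: "?o i \<subseteq> ?o j" if "\<gamma> \<in> \<Gamma>" "\<delta> \<in> \<Gamma>" "\<gamma> (v i) = \<delta> (v j)" for i j \<gamma> \<delta>
  proof clarify
    fix \<eta> assume \<eta>: "\<eta> \<in> \<Gamma>"
    have "v i = (inv\<^bsub>G\<^esub> \<gamma>) (\<delta> (v j))"
      using that by (metis \<Gamma>_carrier inv_apply(2) representative_mem)
    then have "\<eta> (v i) = (\<eta> \<otimes>\<^bsub>G\<^esub> (inv\<^bsub>G\<^esub> \<gamma> \<otimes>\<^bsub>G\<^esub> \<delta>)) (v j)"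
      using that \<eta> by (simp add: mult_apply \<Gamma>_carrier representative_mem graph_aut_closed)
    moreover have "\<eta> \<otimes>\<^bsub>G\<^esub> (inv\<^bsub>G\<^esub> \<gamma> \<otimes>\<^bsub>G\<^esub> \<delta>) \<in> \<Gamma>"
      using that \<eta> subgroup_\<Gamma> by (simp add: subgroup.m_closed subgroup.m_inv_closed)
    ultimately show "\<exists>\<gamma>. \<eta> (v i) = \<gamma> (v j) \<and> \<gamma> \<in> \<Gamma>" by blast
  qed
  have "?o i = ?o j"
    using sub[OF assms] sub[OF assms(2,1) assms(3)[symmetric]] by (rule subset_antisym)
  moreover have "inj ?o"
    using representatives unfolding orbit_representatives_def orbit_\<Gamma> bij_betw_def by blast
  ultimately show "i = j" by (rule injD[rotated])
  then show "\<gamma> = \<delta>"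
    using assms free_action_eq representative_mem by blast
qed

text \<open>A vertex \<open>x = \<gamma> (v i)\<close> is recorded by its orbit \<open>i = cls x\<close> and its lattice cell, the
  coordinate vector of \<open>\<gamma>\<close>.\<close>

definition cls :: "'v \<Rightarrow> 'n" where
  "cls x = (THE i. \<exists>\<gamma>\<in>\<Gamma>. x = \<gamma> (v i))"

definition shift :: "'v \<Rightarrow> 'v \<Rightarrow> 'v" where
  "shift x = (THE \<gamma>. \<gamma> \<in> \<Gamma> \<and> x = \<gamma> (v (cls x)))"

definition cell :: "'v \<Rightarrow> real ^ 'd" where
  "cell x = coord (shift x)"

lemma cls_representative [simp]: "\<gamma> \<in> \<Gamma> \<Longrightarrow> cls (\<gamma> (v i)) = i"
  unfolding cls_def by (rule the_equality) (auto dest: representative_unique)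

lemma shift_representative [simp]: "\<gamma> \<in> \<Gamma> \<Longrightarrow> shift (\<gamma> (v i)) = \<gamma>"
  unfolding shift_def by (rule the_equality) (auto dest: representative_unique)

lemma cls_shift:
  assumes "x \<in> V" shows "shift x \<in> \<Gamma>" "shift x (v (cls x)) = x"
proof -
  obtain i \<gamma> where "\<gamma> \<in> \<Gamma>" "x = \<gamma> (v i)" using vertex_cases[OF assms] .
  then show "shift x \<in> \<Gamma>" "shift x (v (cls x)) = x" by simp_all
qed

text \<open>Writing \<open>x\<close> as \<open>shift x\<close> applied to its representative,
  translation by \<open>\<gamma>\<close> only multiplies the group element, hence adds
  \<open>coord \<gamma>\<close> to the cell.\<close>

lemma translate_vertex:
  assumes "\<gamma> \<in> \<Gamma>" "x \<in> V"
  shows "cls (\<gamma> x) = cls x" "cell (\<gamma> x) = coord \<gamma> + cell x"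
proof -
  have eq: "\<gamma> x = (\<gamma> \<otimes>\<^bsub>G\<^esub> shift x) (v (cls x))"
    using mult_apply[OF \<Gamma>_carrier \<Gamma>_carrier representative_mem, OF assms(1) cls_shift(1)[OF assms(2)]]
    by (simp add: cls_shift(2)[OF assms(2)])
  have mem: "\<gamma> \<otimes>\<^bsub>G\<^esub> shift x \<in> \<Gamma>"
    by (rule subgroup.m_closed[OF subgroup_\<Gamma> assms(1) cls_shift(1)[OF assms(2)]])
  show "cls (\<gamma> x) = cls x"
    unfolding eq by (rule cls_representative[OF mem])
  show "cell (\<gamma> x) = coord \<gamma> + cell x"
    unfolding cell_def eq shift_representative[OF mem]
    by (rule coord_mult[OF assms(1) cls_shift(1)[OF assms(2)]])
qed

lemma representative_cell [simp]: "cls (v i) = i" "cell (v i) = 0"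
proof -
  have 1: "\<one>\<^bsub>G\<^esub> \<in> \<Gamma>" by (rule subgroup.one_closed[OF subgroup_\<Gamma>])
  show "cls (v i) = i" "cell (v i) = 0"
    using cls_representative[OF 1, of i] shift_representative[OF 1, of i]
    by (simp_all only: one_apply[OF representative_mem] cell_def coord_one)
qed

section \<open>The action on parameters\<close>

text \<open>The position of a vertex relative to that of \<open>v i\<^sub>0\<close>, in the basis given by the columns of \<open>\<Lambda>\<close>.\<close>

definition pos :: "real ^ 'd ^ 'n \<Rightarrow> 'v \<Rightarrow> real ^ 'd" where
  "pos t x = t $ cls x + cell x"

lemma pos_translate: "\<gamma> \<in> \<Gamma> \<Longrightarrow> x \<in> V \<Longrightarrow> pos t (\<gamma> x) = coord \<gamma> + pos t x"
  by (simp add: pos_def translate_vertex)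

lemma pos_representative [simp]: "pos t (v i) = t $ i"
  by (simp add: pos_def)

text \<open>The effect on parameters of precomposing a placement with \<open>\<rho>\<close>: the paper's \<open>A(\<rho>\<^sup>-\<^sup>1)\<close>, hence
  a right action.\<close>

definition affine_act :: "('v \<Rightarrow> 'v) \<Rightarrow> ('n, 'd) parameters \<Rightarrow> ('n, 'd) parameters" where
  "affine_act \<rho> a = (\<chi> i. matrix_inv (conj_matrix \<rho>) *v (pos (fst a) (\<rho> (v i)) - pos (fst a) (\<rho> (v i\<^sub>0))),
             transpose (conj_matrix \<rho>) ** snd a ** conj_matrix \<rho>)"

text \<open>Extends the defining formula of \<open>affine_act\<close> from representatives to all
  vertices. Moving \<open>x\<close> by \<open>\<gamma>\<close> moves \<open>\<rho> x\<close> by the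
  conjugate of \<open>\<gamma>\<close>, and the inverse of \<open>conj_matrix \<rho>\<close> turns
  that displacement back into \<open>coord \<gamma>\<close>.\<close>

lemma pos_affine_act:
  assumes "\<rho> \<in> N" "x \<in> V"
  shows "pos (fst (affine_act \<rho> a)) x =
    matrix_inv (conj_matrix \<rho>) *v (pos (fst a) (\<rho> x) - pos (fst a) (\<rho> (v i\<^sub>0)))"
proof -
  obtain i \<gamma> where \<gamma>: "\<gamma> \<in> \<Gamma>" "x = \<gamma> (v i)" using vertex_cases[OF assms(2)] .
  have "pos (fst a) (\<rho> x) = conj_matrix \<rho> *v coord \<gamma> + pos (fst a) (\<rho> (v i))"
    using assms(1) \<gamma> pos_translate[OF conj_by_closed[OF assms(1) \<gamma>(1)], of "\<rho> (v i)"]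
    by (simp add: conj_by_apply representative_mem coord_conj_by graph_aut_closed[of _ V E] N_carrier)
  then show ?thesis
    using \<gamma> invertible_conj_matrix[OF assms(1)]
    by (simp add: pos_translate representative_mem affine_act_def matrix_vector_right_distrib
        matrix_vector_mult_diff_distrib matrix_inv_vector)
qed

text \<open>The vertices \<open>\<tau> (v i)\<close> need not be representatives, which is why
  \<open>pos_affine_act\<close> is needed. The normalising term at
  \<open>\<rho> (v i\<^sub>0)\<close> cancels in the difference of two positions.\<close>

lemma affine_act_mult:
  assumes "\<rho> \<in> N" "\<tau> \<in> N"
  shows "affine_act \<tau> (affine_act \<rho> a) = affine_act (\<rho> \<otimes>\<^bsub>G\<^esub> \<tau>) a"
proof -
  have \<tau>: "\<tau> (v i) \<in> V" for i
    by (rule graph_aut_closed[OF N_carrier[OF assms(2)] representative_mem])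
  have inv: "matrix_inv (conj_matrix (\<rho> \<otimes>\<^bsub>G\<^esub> \<tau>)) =
      matrix_inv (conj_matrix \<tau>) ** matrix_inv (conj_matrix \<rho>)"
    using assms by (simp add: conj_matrix_mult matrix_inv_mult invertible_conj_matrix)
  have "fst (affine_act \<tau> (affine_act \<rho> a)) $ i = fst (affine_act (\<rho> \<otimes>\<^bsub>G\<^esub> \<tau>) a) $ i" for i
  proof -
    have "fst (affine_act \<tau> (affine_act \<rho> a)) $ i =
        matrix_inv (conj_matrix \<tau>) *v
          (pos (fst (affine_act \<rho> a)) (\<tau> (v i)) - pos (fst (affine_act \<rho> a)) (\<tau> (v i\<^sub>0)))"
      by (simp add: affine_act_def)
    also have "\<dots> = matrix_inv (conj_matrix \<tau>) *v (matrix_inv (conj_matrix \<rho>) *v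
        (pos (fst a) (\<rho> (\<tau> (v i))) - pos (fst a) (\<rho> (\<tau> (v i\<^sub>0)))))"
      by (simp add: pos_affine_act[OF assms(1) \<tau>] matrix_vector_mult_diff_distrib)
    also have "\<dots> = fst (affine_act (\<rho> \<otimes>\<^bsub>G\<^esub> \<tau>) a) $ i"
      using assms by (simp add: affine_act_def inv mult_apply N_carrier representative_mem flip: matrix_vector_mul_assoc)
    finally show ?thesis .
  qed
  moreover have "snd (affine_act \<tau> (affine_act \<rho> a)) = snd (affine_act (\<rho> \<otimes>\<^bsub>G\<^esub> \<tau>) a)"
    using assms by (simp add: affine_act_def conj_matrix_mult matrix_transpose_mul matrix_mul_assoc)
  ultimately show ?thesis by (simp add: prod_eq_iff vec_eq_iff)
qed

lemma affine_act_closed: "\<rho> \<in> N \<Longrightarrow> a \<in> parameter_space i\<^sub>0 \<Longrightarrow> affine_act \<rho> a \<in> parameter_space i\<^sub>0"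
  by (auto simp: parameter_space_def affine_act_def intro!: congruence_positive_definite invertible_conj_matrix)

section \<open>Placements and their parameter points\<close>

lemma placementD:
  fixes p :: "'v \<Rightarrow> real ^ 'd"
  assumes "periodic_placement V E \<Gamma> (p, \<pi>)"
  defines "\<Lambda> \<equiv> lattice_matrix \<phi> \<pi>"
  shows "\<And>\<gamma>. \<gamma> \<in> \<Gamma> \<Longrightarrow> \<pi> \<gamma> = \<Lambda> *v coord \<gamma>"
    and "invertible \<Lambda>"
    and "\<And>x. x \<in> V \<Longrightarrow> p x = p (v i\<^sub>0) + \<Lambda> *v pos (fst (parameter_point \<phi> v i\<^sub>0 (p, \<pi>))) x"
proof -
  have hom: "\<pi> (\<gamma> \<otimes>\<^bsub>G\<^esub> \<delta>) = \<pi> \<gamma> + \<pi> \<delta>" if "\<gamma> \<in> \<Gamma>" "\<delta> \<in> \<Gamma>" for \<gamma> \<delta>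
    using assms(1) that by (simp add: periodic_placement_def hom_def translation_group_def)
  have lat: "lattice_of_rank CARD('d) (\<pi> ` \<Gamma>)"
    and act: "\<And>\<gamma> x. \<gamma> \<in> \<Gamma> \<Longrightarrow> x \<in> V \<Longrightarrow> p (\<gamma> x) = p x + \<pi> \<gamma>"
    using assms(1) by (simp_all add: periodic_placement_def)
  show lin: "\<pi> \<gamma> = \<Lambda> *v coord \<gamma>" if "\<gamma> \<in> \<Gamma>" for \<gamma>
    unfolding \<Lambda>_def by (rule hom_\<Gamma>_linear[OF hom that])
  obtain B :: "(real ^ 'd) set" where B: "finite B" "card B = CARD('d)" "independent B"
    "\<pi> ` \<Gamma> = range (\<lambda>c :: real ^ 'd \<Rightarrow> int. \<Sum>b\<in>B. of_int (c b) *\<^sub>R b)"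
    using lat by (auto simp: lattice_of_rank_def)
  \<comment> \<open>The image of \<open>\<Gamma>\<close> contains a basis of the whole space and
    lies in the range of \<open>\<Lambda>\<close>, so \<open>\<Lambda>\<close> is
    surjective.\<close>
  have "B \<subseteq> range ((*v) \<Lambda>)"
  proof
    fix b assume b: "b \<in> B"
    \<comment> \<open>A basis vector is itself a lattice point, with coefficient 1 at
      \<open>b\<close> and 0 elsewhere.\<close>
    have "b = (\<Sum>x\<in>B. of_int (if x = b then 1 else 0) *\<^sub>R x)"
      using B(1) b by (simp add: if_distrib[of of_int] if_distrib[of "\<lambda>c. c *\<^sub>R _"] sum.delta cong: if_cong)
    then have "b \<in> \<pi> ` \<Gamma>"
      unfolding B(4) by (rule image_eqI[where x = "\<lambda>x. if x = b then 1 else 0", OF _ UNIV_I])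
    then show "b \<in> range ((*v) \<Lambda>)" using lin by auto
  qed
  then have "span B \<subseteq> range ((*v) \<Lambda>)"
    by (intro span_minimal linear_subspace_image) auto
  moreover have "UNIV \<subseteq> span B"
    using B by (intro card_ge_dim_independent) auto
  ultimately have "surj ((*v) \<Lambda>)" by auto
  then show inv: "invertible \<Lambda>"
    by (simp add: invertible_right_inverse matrix_right_invertible_surjective)
  fix x assume x: "x \<in> V"
  have "p x = p (v (cls x)) + \<Lambda> *v cell x"
    using act[OF cls_shift(1)[OF x] representative_mem, of "cls x"] lin[OF cls_shift(1)[OF x]]
    by (simp add: cls_shift(2)[OF x] cell_def)
  also have "p (v i) = p (v i\<^sub>0) + \<Lambda> *v (fst (parameter_point \<phi> v i\<^sub>0 (p, \<pi>)) $ i)" for i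
    by (simp add: parameter_point_def Let_def flip: \<Lambda>_def)
       (simp add: matrix_inv_vector[OF inv])
  finally show "p x = p (v i\<^sub>0) + \<Lambda> *v pos (fst (parameter_point \<phi> v i\<^sub>0 (p, \<pi>))) x"
    by (simp add: pos_def matrix_vector_right_distrib)
qed

lemma parameter_point_in_space:
  assumes "periodic_placement V E \<Gamma> P"
  shows "parameter_point \<phi> v i\<^sub>0 P \<in> parameter_space i\<^sub>0"
  using assms placementD(2)[of "fst P" "snd P"]
  by (auto simp: parameter_point_def Let_def parameter_space_def split_beta gram_positive_definite)

lemma placement_exists:
  assumes "a \<in> parameter_space i\<^sub>0"
  obtains P where "periodic_placement V E \<Gamma> P" "parameter_point \<phi> v i\<^sub>0 P = a"
proof -
  have a: "fst a $ i\<^sub>0 = 0" "snd a \<in> positive_definite_cone"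
    using assms by (auto simp: parameter_space_def)
  obtain \<Lambda> :: "real ^ 'd ^ 'd" where \<Lambda>: "invertible \<Lambda>" "transpose \<Lambda> ** \<Lambda> = snd a"
    using positive_definite_factorization[OF a(2)] .
  \<comment> \<open>The vertex \<open>v i\<^sub>0\<close> lands at the origin because the coordinate
    of \<open>a\<close> at \<open>i\<^sub>0\<close> is 0; \<open>\<Lambda>\<close> realises the
    prescribed Gram matrix.\<close>
  define P where "P = (\<lambda>x. \<Lambda> *v pos (fst a) x, \<lambda>\<gamma>. \<Lambda> *v coord \<gamma>)"
  have \<Gamma>_eq: "\<Gamma> = range \<phi>" using \<phi>_bij by (simp add: bij_betw_def)
  have "(\<lambda>\<gamma>. \<Lambda> *v coord \<gamma>) ` \<Gamma> = range (\<lambda>z. \<Lambda> *v int_vec z)"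
    unfolding \<Gamma>_eq image_image coord_\<phi> ..
  moreover have "inj_on (\<lambda>\<gamma>. \<Lambda> *v coord \<gamma>) \<Gamma>"
    by (rule inj_onI) (metis \<Lambda>(1) coord_inj inj_onD matrix_inv_vector(1))
  ultimately have "periodic_placement V E \<Gamma> P"
    using \<Lambda>(1) by (simp add: P_def periodic_placement_def hom_def translation_group_def coord_mult
        matrix_vector_right_distrib lattice_of_rank_columns pos_translate add.commute)
  moreover have "lattice_matrix \<phi> (\<lambda>\<gamma>. \<Lambda> *v coord \<gamma>) = \<Lambda>"
    by (auto simp: lattice_matrix_def matrix_vector_axis column_def vec_eq_iff)
  then have "parameter_point \<phi> v i\<^sub>0 P = a"
    by (simp add: P_def parameter_point_def Let_def \<Lambda> a matrix_inv_vector prod_eq_iff)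
  ultimately show thesis by (rule that)
qed

text \<open>Precomposition with \<open>\<rho>\<close>, the inverse of \<open>\<sigma>\<close>,
  changes the lattice basis from \<open>\<Lambda>\<close> to
  \<open>\<Lambda> ** conj_matrix \<rho>\<close>. The formula for \<open>affine_act\<close> follows
  by changing basis in the positions and in the Gram matrix.\<close>

lemma parameter_point_act:
  assumes P: "periodic_placement V E \<Gamma> P" and \<sigma>: "\<sigma> \<in> N"
  shows "parameter_point \<phi> v i\<^sub>0 (placement_act V E \<sigma> P) =
    affine_act (inv\<^bsub>G\<^esub> \<sigma>) (parameter_point \<phi> v i\<^sub>0 P)"
proof -
  obtain p \<pi> where P_eq: "P = (p, \<pi>)" by fastforce
  define \<rho> where "\<rho> = inv\<^bsub>G\<^esub> \<sigma>"
  have \<rho>: "\<rho> \<in> N" using \<sigma> by (simp add: \<rho>_def subgroup.m_inv_closed[OF subgroup_N])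
  define \<Lambda> where "\<Lambda> = lattice_matrix \<phi> \<pi>"
  define a where "a = parameter_point \<phi> v i\<^sub>0 (p, \<pi>)"
  note D = placementD[OF P[unfolded P_eq], folded \<Lambda>_def a_def]
  have L: "lattice_matrix \<phi> (\<pi> \<circ> conj_by V E \<rho>) = \<Lambda> ** conj_matrix \<rho>"
  proof (rule matrix_eq_on_axes)
    fix j
    have "lattice_matrix \<phi> (\<pi> \<circ> conj_by V E \<rho>) *v axis j 1 = \<pi> (conj_by V E \<rho> (\<phi> (frag_of j)))"
      by (simp add: lattice_matrix_def matrix_vector_axis column_def vec_eq_iff)
    also have "\<dots> = \<Lambda> *v (conj_matrix \<rho> *v axis j 1)"
      using \<rho> by (simp add: D(1) conj_by_closed coord_conj_by)
    finally show "lattice_matrix \<phi> (\<pi> \<circ> conj_by V E \<rho>) *v axis j 1 = \<Lambda> ** conj_matrix \<rho> *v axis j 1"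
      by (simp add: matrix_vector_mul_assoc)
  qed
  have "p (\<rho> (v i)) - p (\<rho> (v i\<^sub>0)) = \<Lambda> *v (pos (fst a) (\<rho> (v i)) - pos (fst a) (\<rho> (v i\<^sub>0)))" for i
    using D(3)[OF graph_aut_closed[OF N_carrier[OF \<rho>] representative_mem]]
    by (simp add: matrix_vector_mult_diff_distrib)
  moreover have "snd a = transpose \<Lambda> ** \<Lambda>"
    by (simp add: a_def parameter_point_def Let_def \<Lambda>_def)
  ultimately show ?thesis
    using invertible_conj_matrix[OF \<rho>] D(2)
    unfolding P_eq a_def[symmetric] \<rho>_def[symmetric]
    by (simp add: placement_act_def parameter_point_def Let_def L affine_act_def matrix_inv_mult
        matrix_transpose_mul matrix_mul_assoc matrix_inv_vector flip: matrix_vector_mul_assoc \<rho>_def)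
qed

text \<open>The description in \<open>parameter_act\<close> is well defined: some placement has
  parameter point \<open>a\<close>, and the new parameter point depends on \<open>a\<close>
  alone.\<close>

lemma parameter_act_eq:
  assumes "a \<in> parameter_space i\<^sub>0" "\<sigma> \<in> N"
  shows "parameter_act V E \<Gamma> \<phi> v i\<^sub>0 \<sigma> a = affine_act (inv\<^bsub>G\<^esub> \<sigma>) a"
proof -
  obtain P where P: "periodic_placement V E \<Gamma> P" "parameter_point \<phi> v i\<^sub>0 P = a"
    using placement_exists[OF assms(1)] .
  show ?thesis
    unfolding parameter_act_def
  proof (rule the_equality)
    show "\<exists>P. periodic_placement V E \<Gamma> P \<and> parameter_point \<phi> v i\<^sub>0 P = a \<and>
        parameter_point \<phi> v i\<^sub>0 (placement_act V E \<sigma> P) =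
    affine_act (inv\<^bsub>G\<^esub> \<sigma>) a"
      using P parameter_point_act[OF P(1) assms(2)] by (intro exI[of _ P]) simp
  next
    fix y
    assume "\<exists>P. periodic_placement V E \<Gamma> P \<and> parameter_point \<phi> v i\<^sub>0 P = a \<and>
        parameter_point \<phi> v i\<^sub>0 (placement_act V E \<sigma> P) = y"
    then show "y = affine_act (inv\<^bsub>G\<^esub> \<sigma>) a"
      using parameter_point_act[OF _ assms(2)] by auto
  qed
qed

text \<open>The inverse in the left action disappears because \<open>\<Sigma>\<close> is closed
  under inverses.\<close>

lemma fixed_parameters_eq:
  assumes "\<Sigma> \<in> crystallographic_subgroups V E \<Gamma>"
  shows "fixed_parameters V E \<Gamma> \<phi> v i\<^sub>0 \<Sigma> = {a \<in> parameter_space i\<^sub>0. \<forall>\<sigma>\<in>\<Sigma>. affine_act \<sigma> a = a}"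
proof -
  have \<Sigma>: "subgroup \<Sigma> G" "\<Sigma> \<subseteq> N"
    using assms by (auto simp: crystallographic_subgroups_def)
  have "(\<forall>\<sigma>\<in>\<Sigma>. affine_act (inv\<^bsub>G\<^esub> \<sigma>) a = a) \<longleftrightarrow> (\<forall>\<sigma>\<in>\<Sigma>. affine_act \<sigma> a = a)" for a
    using subgroup.m_inv_closed[OF \<Sigma>(1)] subgroup.mem_carrier[OF \<Sigma>(1)] by (metis inv_inv)
  moreover have "parameter_act V E \<Gamma> \<phi> v i\<^sub>0 \<sigma> a = affine_act (inv\<^bsub>G\<^esub> \<sigma>) a"
    if "a \<in> parameter_space i\<^sub>0" "\<sigma> \<in> \<Sigma>" for a \<sigma>
    using parameter_act_eq[OF that(1)] that(2) \<Sigma>(2) by blast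
  ultimately show ?thesis
    unfolding fixed_parameters_def by (intro Collect_cong conj_cong refl) simp
qed

section \<open>Finiteness and fixed points\<close>

text \<open>A translation adds the same vector to the cells of both endpoints, so each of the
  finitely many edge orbits contributes at most two displacements, one for each orientation.\<close>

lemma finite_edge_displacements: "finite {cell y - cell x | x y. {x, y} \<in> E}"
proof -
  let ?D = "\<lambda>X. {cell y - cell x | x y. {x, y} \<in> X}"
  have "finite (?D X)" if X: "X \<in> edge_orbits V E \<Gamma>" for X
  proof -
    obtain e where e: "e \<in> E" "X = {\<gamma> ` e | \<gamma>. \<gamma> \<in> \<Gamma>}"
      using X by (auto simp: edge_orbits_def orbits_def orbit_def)
    have "e \<subseteq> V" "card e = 2"
      using e(1) periodic by (auto simp: periodic_graph_def simple_graph_def)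
    then obtain a b where ab: "e = {a, b}" "a \<in> V" "b \<in> V"
      by (auto simp: card_2_iff)
    have "?D X \<subseteq> {cell b - cell a, cell a - cell b}"
      using ab by (auto simp: e(2) doubleton_eq_iff translate_vertex)
    then show ?thesis by (rule finite_subset) simp
  qed
  moreover have "finite (edge_orbits V E \<Gamma>)"
    using periodic by (simp add: periodic_graph_def)
  ultimately have "finite (\<Union>X\<in>edge_orbits V E \<Gamma>. ?D X)" by blast
  moreover have "\<exists>X\<in>edge_orbits V E \<Gamma>. e \<in> X" if "e \<in> E" for e
  proof
    have "e \<subseteq> V" using that periodic by (auto simp: periodic_graph_def simple_graph_def)
    then have "\<one>\<^bsub>G\<^esub> ` e = e" using one_apply by (force simp: image_iff)
    then show "e \<in> {\<gamma> ` e | \<gamma>. \<gamma> \<in> \<Gamma>}"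
      using subgroup.one_closed[OF subgroup_\<Gamma>] by (metis (mono_tags, lifting) mem_Collect_eq)
    show "{\<gamma> ` e | \<gamma>. \<gamma> \<in> \<Gamma>} \<in> edge_orbits V E \<Gamma>"
      using that by (auto simp: edge_orbits_def orbits_def orbit_def)
  qed
  then have "{cell y - cell x | x y. {x, y} \<in> E} \<subseteq> (\<Union>X\<in>edge_orbits V E \<Gamma>. ?D X)"
    by blast
  ultimately show ?thesis by (rule finite_subset[rotated])
qed

text \<open>Automorphisms preserve edges, so along a path from \<open>x\<close> to \<open>y\<close> the displacement changes by one of
  finitely many amounts at each step, whatever \<open>\<rho>\<close> is.\<close>

lemma finite_displacements:
  assumes "x \<in> V" "y \<in> V"
  shows "finite {cell (\<rho> y) - cell (\<rho> x) | \<rho>. \<rho> \<in> N}"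
proof -
  have "(x, y) \<in> {(x, y). {x, y} \<in> E}\<^sup>*"
    using assms periodic by (simp add: periodic_graph_def connected_graph_def)
  then show ?thesis
  proof (induction rule: rtrancl_induct)
    case base
    show ?case by (rule finite_subset[of _ "{0}"]) auto
  next
    case (step y z)
    let ?D = "{cell y - cell x | x y. {x, y} \<in> E}"
    let ?S = "{cell (\<rho> y) - cell (\<rho> x) | \<rho>. \<rho> \<in> N}"
    have yz: "{y, z} \<in> E" using step.hyps by simp
    then have V: "y \<in> V" "z \<in> V"
      using periodic by (auto simp: periodic_graph_def simple_graph_def)
    have "cell (\<rho> z) - cell (\<rho> x) \<in> (\<lambda>(a, b). a + b) ` (?S \<times> ?D)" if "\<rho> \<in> N" for \<rho>
    proof (rule image_eqI)
      show "cell (\<rho> z) - cell (\<rho> x) = (\<lambda>(a, b). a + b) (cell (\<rho> y) - cell (\<rho> x), cell (\<rho> z) - cell (\<rho> y))"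
        by simp
      have "{\<rho> y, \<rho> z} \<in> E"
        using yz graph_aut_edge[OF N_carrier[OF that] V] by simp
      then show "(cell (\<rho> y) - cell (\<rho> x), cell (\<rho> z) - cell (\<rho> y)) \<in> ?S \<times> ?D"
        using that by blast
    qed
    then have "{cell (\<rho> z) - cell (\<rho> x) | \<rho>. \<rho> \<in> N} \<subseteq> (\<lambda>(a, b). a + b) ` (?S \<times> ?D)"
      by blast
    moreover have "finite ((\<lambda>(a, b). a + b) ` (?S \<times> ?D))"
      using step.IH finite_edge_displacements by blast
    ultimately show ?case by (rule finite_subset)
  qed
qed

text \<open>The map \<open>affine_act \<rho>\<close> is determined by three finite families: the
  columns \<open>c\<close> of \<open>conj_matrix \<rho>\<close>, the orbits \<open>k\<close> of the
  images of the representatives, and their cells \<open>s\<close> relative to the image of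
  \<open>v i\<^sub>0\<close>. Each entry ranges over a finite set.\<close>

lemma finite_affine_act: "finite (affine_act ` N)"
proof -
  define c where "c \<rho> = (\<lambda>j. cell (\<rho> (\<phi> (frag_of j) (v i\<^sub>0))) - cell (\<rho> (v i\<^sub>0)))" for \<rho>
  define k where "k \<rho> = (\<lambda>i. cls (\<rho> (v i)))" for \<rho>
  define s where "s \<rho> = (\<lambda>i. cell (\<rho> (v i)) - cell (\<rho> (v i\<^sub>0)))" for \<rho>
  define \<Phi> :: "('d \<Rightarrow> real ^ 'd) \<times> ('n \<Rightarrow> 'n) \<times> ('n \<Rightarrow> real ^ 'd) \<Rightarrow> ('n, 'd) parameters \<Rightarrow> ('n, 'd) parameters"
    where "\<Phi> = (\<lambda>(c, k, s) a. let A = \<chi> i j. c j $ i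
      in (\<chi> i. matrix_inv A *v (fst a $ k i - fst a $ k i\<^sub>0 + s i), transpose A ** snd a ** A))"
  have "affine_act \<rho> = \<Phi> (c \<rho>, k \<rho>, s \<rho>)" if \<rho>: "\<rho> \<in> N" for \<rho>
  proof -
    have "(\<chi> i j. c \<rho> j $ i) = conj_matrix \<rho>"
    proof (rule matrix_eq_on_axes)
      fix j
      \<comment> \<open>Applying \<open>\<rho>\<close> to the \<open>j\<close>-th lattice translate
        of \<open>v i\<^sub>0\<close> gives a translate of \<open>\<rho> (v i\<^sub>0)\<close> by
        the conjugated generator, so column \<open>j\<close> is itself a displacement.\<close>
      have "cell (\<rho> (\<phi> (frag_of j) (v i\<^sub>0))) = conj_matrix \<rho> *v axis j 1 + cell (\<rho> (v i\<^sub>0))"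
        using \<rho> translate_vertex(2)[OF conj_by_closed[OF \<rho> \<phi>_mem], of "\<rho> (v i\<^sub>0)" "frag_of j"]
        by (simp add: conj_by_apply representative_mem coord_conj_by graph_aut_closed[of _ V E] N_carrier)
      then show "(\<chi> i j. c \<rho> j $ i) *v axis j 1 = conj_matrix \<rho> *v axis j 1"
        by (simp add: c_def matrix_vector_axis column_def vec_eq_iff)
    qed
    then show ?thesis
      by (simp add: fun_eq_iff \<Phi>_def Let_def affine_act_def pos_def k_def s_def algebra_simps)
  qed
  then have "affine_act ` N \<subseteq> \<Phi> ` (\<lambda>\<rho>. (c \<rho>, k \<rho>, s \<rho>)) ` N" by auto
  moreover have "finite ((\<lambda>\<rho>. (c \<rho>, k \<rho>, s \<rho>)) ` N)"
  proof (rule finite_subset)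
    let ?S = "\<lambda>x. {cell (\<rho> x) - cell (\<rho> (v i\<^sub>0)) | \<rho>. \<rho> \<in> N}"
    show "(\<lambda>\<rho>. (c \<rho>, k \<rho>, s \<rho>)) ` N \<subseteq>
        PiE UNIV (\<lambda>j. ?S (\<phi> (frag_of j) (v i\<^sub>0))) \<times> UNIV \<times> PiE UNIV (\<lambda>i. ?S (v i))"
      by (auto simp: c_def s_def)
    have "\<phi> (frag_of j) (v i\<^sub>0) \<in> V" for j
      by (rule graph_aut_closed[OF \<Gamma>_carrier[OF \<phi>_mem] representative_mem])
    then show "finite (PiE UNIV (\<lambda>j. ?S (\<phi> (frag_of j) (v i\<^sub>0))) \<times> (UNIV :: ('n \<Rightarrow> 'n) set)
        \<times> PiE UNIV (\<lambda>i. ?S (v i)))"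
      by (intro finite_cartesian_product finite_PiE finite_displacements representative_mem) simp_all
  qed
  ultimately show ?thesis by (meson finite_imageI finite_subset)
qed

section \<open>Affineness of the action and fixed points by averaging\<close>

lemma linear_affine_act: "linear (\<lambda>a. affine_act \<rho> a - affine_act \<rho> 0)"
proof -
  \<comment> \<open>The cells are the only terms independent of \<open>a\<close>; subtracting the
    value at 0 removes them and leaves an expression linear in \<open>a\<close>.\<close>
  have eq: "affine_act \<rho> a - affine_act \<rho> 0 =
      (\<chi> i. matrix_inv (conj_matrix \<rho>) *v
        (fst a $ cls (\<rho> (v i)) - fst a $ cls (\<rho> (v i\<^sub>0))),
      transpose (conj_matrix \<rho>) ** snd a ** conj_matrix \<rho>)" for a
    by (simp add: affine_act_def pos_def prod_eq_iff vec_eq_iff flip: matrix_vector_mult_diff_distrib)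
  have add: "(A + B) ** C = A ** C + B ** C" for A B C :: "real ^ 'd ^ 'd"
    by (simp add: matrix_matrix_mult_def vec_eq_iff sum.distrib distrib_right)
  have scale: "A ** (r *\<^sub>R B) = r *\<^sub>R (A ** B)" for A B :: "real ^ 'd ^ 'd" and r
    by (simp only: matrix_scalar_ac scalar_matrix_assoc)
  show ?thesis
    unfolding eq
  proof (rule linearI)
    fix a b :: "('n, 'd) parameters" and r :: real
    let ?L = "\<lambda>a. (\<chi> i. matrix_inv (conj_matrix \<rho>) *v
        (fst a $ cls (\<rho> (v i)) - fst a $ cls (\<rho> (v i\<^sub>0))),
      transpose (conj_matrix \<rho>) ** snd a ** conj_matrix \<rho>)"
    show "?L (a + b) = ?L a + ?L b"
      by (simp add: prod_eq_iff vec_eq_iff matrix_vector_mult_diff_distrib matrix_vector_right_distrib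
          matrix_add_ldistrib add)
    show "?L (r *\<^sub>R a) = r *\<^sub>R ?L a"
      by (simp add: prod_eq_iff vec_eq_iff matrix_vector_mult_diff_distrib matrix_vector_mult_scaleR
          scale scaleR_diff_right flip: scalar_matrix_assoc)
  qed
qed

text \<open>The formula for \<open>affine_act\<close> also makes sense outside the positive definite
  cone, so the fixed set can be taken in the whole ambient space; this is the affine subspace that
  cuts out the section.\<close>

lemma affine_fixed: "affine {a \<in> parameter_ambient i\<^sub>0. \<forall>\<sigma>\<in>\<Sigma>. affine_act \<sigma> a = a}"
  unfolding affine_def
proof (intro ballI allI impI)
  fix a b and u w :: real
  assume *: "a \<in> {a \<in> parameter_ambient i\<^sub>0. \<forall>\<sigma>\<in>\<Sigma>. affine_act \<sigma> a = a}"
    "b \<in> {a \<in> parameter_ambient i\<^sub>0. \<forall>\<sigma>\<in>\<Sigma>. affine_act \<sigma> a = a}" "u + w = 1"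
  have "affine_act \<sigma> (u *\<^sub>R a + w *\<^sub>R b) = u *\<^sub>R a + w *\<^sub>R b" if "\<sigma> \<in> \<Sigma>" for \<sigma>
  proof -
    have "affine_act \<sigma> (u *\<^sub>R a + w *\<^sub>R b) - affine_act \<sigma> 0 =
        u *\<^sub>R (affine_act \<sigma> a - affine_act \<sigma> 0) + w *\<^sub>R (affine_act \<sigma> b - affine_act \<sigma> 0)"
      using linear_add[OF linear_affine_act] linear_scale[OF linear_affine_act] by metis
    \<comment> \<open>The constant part is counted \<open>u + w = 1\<close> times, so it cancels
      against the one on the left.\<close>
    also have "\<dots> = u *\<^sub>R a + w *\<^sub>R b - (u + w) *\<^sub>R affine_act \<sigma> 0"
      using *(1,2) that by (simp add: algebra_simps)
    finally show ?thesis using *(3) by simp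
  qed
  moreover have "u *\<^sub>R a + w *\<^sub>R b \<in> parameter_ambient i\<^sub>0"
    using * by (intro mem_affine[OF affine_parameter_ambient]) simp_all
  ultimately show "u *\<^sub>R a + w *\<^sub>R b \<in> {a \<in> parameter_ambient i\<^sub>0. \<forall>\<sigma>\<in>\<Sigma>. affine_act \<sigma> a = a}"
    by simp
qed

text \<open>Each map permutes the finite orbit \<open>X\<close>, so it preserves the barycentre by
  affineness; convexity keeps the barycentre in the parameter space.\<close>

lemma fixed_point_exists:
  assumes \<Sigma>: "subgroup \<Sigma> G" "\<Sigma> \<subseteq> N"
  shows "\<exists>a\<in>parameter_space i\<^sub>0. \<forall>\<sigma>\<in>\<Sigma>. affine_act \<sigma> a = a"
proof -
  define b :: "('n, 'd) parameters" where "b = (0, mat 1)"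
  have b: "b \<in> parameter_space i\<^sub>0"
    by (simp add: b_def parameter_space_def mat_1_positive_definite)
  define X where "X = (\<lambda>\<sigma>. affine_act \<sigma> b) ` \<Sigma>"
  have "X \<subseteq> (\<lambda>f. f b) ` affine_act ` N" using \<Sigma>(2) by (auto simp: X_def)
  then have fin: "finite X" using finite_affine_act by (meson finite_imageI finite_subset)
  have "X \<noteq> {}" using subgroup.one_closed[OF \<Sigma>(1)] by (auto simp: X_def)
  then have card: "card X > 0" using fin by (simp add: card_gt_0_iff)
  have sub: "X \<subseteq> parameter_space i\<^sub>0" 
    unfolding X_def using affine_act_closed[OF _ b] \<Sigma>(2) by blast
  define a where "a = (\<Sum>x\<in>X. (1 / real (card X)) *\<^sub>R x)"
  have "a \<in> parameter_space i\<^sub>0"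
    unfolding a_def using fin card sub by (intro convex_sum[OF _ convex_parameter_space]) auto
  moreover have "affine_act \<tau> a = a" if \<tau>: "\<tau> \<in> \<Sigma>" for \<tau>
  proof -
    \<comment> \<open>One inclusion is enough: for a finite set it forces equality and hence
      injectivity. Since the action is a right action, the preimage of the point given by
      \<open>\<sigma>\<close> comes from \<open>\<sigma>\<close> times the inverse of
      \<open>\<tau>\<close>.\<close>
    have "X \<subseteq> affine_act \<tau> ` X"
    proof
      fix x assume "x \<in> X"
      then obtain \<sigma> where \<sigma>: "\<sigma> \<in> \<Sigma>" "x = affine_act \<sigma> b" by (auto simp: X_def)
      define \<rho> where "\<rho> = \<sigma> \<otimes>\<^bsub>G\<^esub> inv\<^bsub>G\<^esub> \<tau>"
      have \<rho>: "\<rho> \<in> \<Sigma>" using \<sigma> \<tau> \<Sigma>(1) by (simp add: \<rho>_def subgroup.m_closed subgroup.m_inv_closed)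
      have "\<rho> \<otimes>\<^bsub>G\<^esub> \<tau> = \<sigma>"
        using subgroup.mem_carrier[OF \<Sigma>(1)] \<sigma> \<tau> by (simp add: \<rho>_def m_assoc)
      then have "x = affine_act \<tau> (affine_act \<rho> b)"
        using affine_act_mult[OF subsetD[OF \<Sigma>(2) \<rho>] subsetD[OF \<Sigma>(2) \<tau>]] \<sigma>(2) by simp
      then show "x \<in> affine_act \<tau> ` X" using \<rho> by (auto simp: X_def)
    qed
    then have img: "affine_act \<tau> ` X = X"
      by (metis card_image_le card_seteq fin finite_imageI)
    then have inj: "inj_on (affine_act \<tau>) X"
      using fin by (simp add: eq_card_imp_inj_on)
    have "affine_act \<tau> a - affine_act \<tau> 0 =
        (\<Sum>x\<in>X. (1 / real (card X)) *\<^sub>R (affine_act \<tau> x - affine_act \<tau> 0))"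
      unfolding a_def linear_sum[OF linear_affine_act] linear_scale[OF linear_affine_act] ..
    \<comment> \<open>The weights sum to 1, so the constant part comes out exactly once.\<close>
    also have "\<dots> = (\<Sum>x\<in>X. (1 / real (card X)) *\<^sub>R affine_act \<tau> x) - affine_act \<tau> 0"
      using card by (simp add: scaleR_diff_right sum_subtractf sum_constant_scaleR)
    also have "(\<Sum>x\<in>X. (1 / real (card X)) *\<^sub>R affine_act \<tau> x) = a"
      unfolding a_def using sum.reindex[OF inj, of "\<lambda>x. (1 / real (card X)) *\<^sub>R x"] img by simp
    finally show ?thesis by simp
  qed
  ultimately show ?thesis by blast
qed

text \<open>An isometry inducing \<open>\<sigma>\<close> has linear part \<open>U\<close> with
  \<open>U ** \<Lambda> = \<Lambda> ** conj_matrix \<sigma>\<close>. Orthogonality of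
  \<open>U\<close> then matches invariance of the Gram matrix, and compatibility with
  \<open>p\<close> matches invariance of the relative positions.\<close>

lemma symmetry_iff_fixed:
  assumes P: "periodic_placement V E \<Gamma> P" and \<sigma>: "\<sigma> \<in> N"
  shows "framework_symmetry V E \<Gamma> P \<sigma> \<longleftrightarrow>
    affine_act \<sigma> (parameter_point \<phi> v i\<^sub>0 P) = parameter_point \<phi> v i\<^sub>0 P"
proof -
  obtain p \<pi> where P_eq: "P = (p, \<pi>)" by fastforce
  define \<Lambda> where "\<Lambda> = lattice_matrix \<phi> \<pi>"
  define a where "a = parameter_point \<phi> v i\<^sub>0 P"
  note D = placementD[OF P[unfolded P_eq], folded \<Lambda>_def, folded P_eq, folded a_def]
  have snd_a: "snd a = transpose \<Lambda> ** \<Lambda>"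
    by (simp add: a_def parameter_point_def Let_def P_eq \<Lambda>_def)
  have fst_a: "fst a $ i\<^sub>0 = 0"
    using parameter_point_in_space[OF P] by (auto simp: a_def[symmetric] parameter_space_def)
  have \<sigma>V: "x \<in> V \<Longrightarrow> \<sigma> x \<in> V" for x using graph_aut_closed[OF N_carrier[OF \<sigma>]] .
  have "framework_symmetry V E \<Gamma> P \<sigma> \<longleftrightarrow> (\<exists>U t. orthogonal_matrix U \<and> (\<forall>x\<in>V. U *v p x + t = p (\<sigma> x)))"
    using \<sigma> by (auto simp: framework_symmetry_def P_eq euclidean_isometries_def)
  also have "\<dots> \<longleftrightarrow> affine_act \<sigma> a = a"
  proof
    assume "\<exists>U t. orthogonal_matrix U \<and> (\<forall>x\<in>V. U *v p x + t = p (\<sigma> x))"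
    then obtain U t where U: "orthogonal_matrix U" and s: "\<And>x. x \<in> V \<Longrightarrow> U *v p x + t = p (\<sigma> x)"
      by blast
    \<comment> \<open>Subtracting the equation at \<open>v i\<^sub>0\<close> eliminates the
      translation part \<open>t\<close>.\<close>
    have key: "(U ** \<Lambda>) *v pos (fst a) x = \<Lambda> *v (pos (fst a) (\<sigma> x) - pos (fst a) (\<sigma> (v i\<^sub>0)))"
      if "x \<in> V" for x
    proof -
      have "U *v (p x - p (v i\<^sub>0)) = p (\<sigma> x) - p (\<sigma> (v i\<^sub>0))"
        using s[OF that] s[OF representative_mem, of i\<^sub>0]
        by (simp add: matrix_vector_mult_diff_distrib flip: s) (metis add_diff_cancel_right)
      then show ?thesis
        using D(3)[OF that] D(3)[OF \<sigma>V[OF that]] D(3)[OF \<sigma>V[OF representative_mem]]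
        by (simp add: matrix_vector_mult_diff_distrib flip: matrix_vector_mul_assoc)
    qed
    \<comment> \<open>Evaluating \<open>key\<close> at the lattice translates of
      \<open>v i\<^sub>0\<close>, whose positions are exactly the vectors
      \<open>coord \<gamma>\<close>, determines the matrix.\<close>
    have UM: "U ** \<Lambda> = \<Lambda> ** conj_matrix \<sigma>"
    proof (rule matrix_eq_on_\<Gamma>)
      fix \<gamma> assume \<gamma>: "\<gamma> \<in> \<Gamma>"
      have "pos (fst a) (\<sigma> (\<gamma> (v i\<^sub>0))) = conj_matrix \<sigma> *v coord \<gamma> + pos (fst a) (\<sigma> (v i\<^sub>0))"
        using \<sigma> \<gamma> pos_translate[OF conj_by_closed[OF \<sigma> \<gamma>], of "\<sigma> (v i\<^sub>0)"]
        by (simp add: conj_by_apply representative_mem coord_conj_by \<sigma>V)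
      moreover have "pos (fst a) (\<gamma> (v i\<^sub>0)) = coord \<gamma>"
        using \<gamma> by (simp add: pos_translate representative_mem fst_a)
      ultimately show "U ** \<Lambda> *v coord \<gamma> = \<Lambda> ** conj_matrix \<sigma> *v coord \<gamma>"
        using key[of "\<gamma> (v i\<^sub>0)"] graph_aut_closed[OF \<Gamma>_carrier[OF \<gamma>] representative_mem]
        by (simp flip: matrix_vector_mul_assoc)
    qed
    have "fst (affine_act \<sigma> a) $ i = fst a $ i" for i
    proof -
      have "\<Lambda> *v (conj_matrix \<sigma> *v (fst a $ i)) = \<Lambda> *v (pos (fst a) (\<sigma> (v i)) - pos (fst a) (\<sigma> (v i\<^sub>0)))"
        using key[OF representative_mem, of i] by (simp add: UM matrix_vector_mul_assoc)
      then have "conj_matrix \<sigma> *v (fst a $ i) = pos (fst a) (\<sigma> (v i)) - pos (fst a) (\<sigma> (v i\<^sub>0))"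
        by (metis D(2) matrix_inv_vector(1))
      then show ?thesis
        using matrix_inv_vector(1)[OF invertible_conj_matrix[OF \<sigma>], of "fst a $ i"] by (simp add: affine_act_def)
    qed
    moreover have "snd (affine_act \<sigma> a) = snd a"
    proof -
      have "snd (affine_act \<sigma> a) = transpose (\<Lambda> ** conj_matrix \<sigma>) ** (\<Lambda> ** conj_matrix \<sigma>)"
        by (simp add: affine_act_def snd_a matrix_transpose_mul matrix_mul_assoc)
      also have "\<dots> = transpose \<Lambda> ** (transpose U ** U) ** \<Lambda>"
        by (simp add: matrix_transpose_mul matrix_mul_assoc flip: UM)
      also have "\<dots> = snd a"
        using U by (simp add: orthogonal_matrix snd_a)
      finally show ?thesis .
    qed
    ultimately show "affine_act \<sigma> a = a" by (simp add: prod_eq_iff vec_eq_iff)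
  next
    assume fixed: "affine_act \<sigma> a = a"
    \<comment> \<open>The only possible choice, by the relation between \<open>U\<close> and
      \<open>\<Lambda>\<close> found in the other direction.\<close>
    define U where "U = \<Lambda> ** conj_matrix \<sigma> ** matrix_inv \<Lambda>"
    have "transpose U ** U =
        transpose (matrix_inv \<Lambda>) ** (transpose (conj_matrix \<sigma>) ** snd a ** conj_matrix \<sigma>) ** matrix_inv \<Lambda>"
      by (simp add: U_def snd_a matrix_transpose_mul matrix_mul_assoc)
    also have "transpose (conj_matrix \<sigma>) ** snd a ** conj_matrix \<sigma> = snd a"
      using arg_cong[OF fixed, of snd] by (simp add: affine_act_def)
    also have "transpose (matrix_inv \<Lambda>) ** snd a ** matrix_inv \<Lambda> =
        transpose (\<Lambda> ** matrix_inv \<Lambda>) ** (\<Lambda> ** matrix_inv \<Lambda>)"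
      by (simp add: snd_a matrix_transpose_mul matrix_mul_assoc)
    also have "\<dots> = mat 1"
      by (simp add: matrix_inv_right[OF D(2)])
    finally have "orthogonal_matrix U" by (simp add: orthogonal_matrix)
    \<comment> \<open>The translation part is chosen so that the isometry sends
      \<open>p (v i\<^sub>0)\<close> to \<open>p (\<sigma> (v i\<^sub>0))\<close>.\<close>
    moreover have "U *v p x + (p (\<sigma> (v i\<^sub>0)) - U *v p (v i\<^sub>0)) = p (\<sigma> x)" if x: "x \<in> V" for x
    proof -
      have "pos (fst a) x = matrix_inv (conj_matrix \<sigma>) *v (pos (fst a) (\<sigma> x) - pos (fst a) (\<sigma> (v i\<^sub>0)))"
        using pos_affine_act[OF \<sigma> x, of a] by (simp add: fixed)
      then have "conj_matrix \<sigma> *v pos (fst a) x = pos (fst a) (\<sigma> x) - pos (fst a) (\<sigma> (v i\<^sub>0))"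
        by (simp add: matrix_inv_vector[OF invertible_conj_matrix[OF \<sigma>]])
      moreover have "U *v (p x - p (v i\<^sub>0)) = \<Lambda> *v (conj_matrix \<sigma> *v pos (fst a) x)"
        by (simp add: D(3)[OF x] U_def matrix_inv_vector[OF D(2)] flip: matrix_vector_mul_assoc)
      ultimately have "U *v (p x - p (v i\<^sub>0)) = p (\<sigma> x) - p (\<sigma> (v i\<^sub>0))"
        by (simp add: D(3)[OF \<sigma>V[OF x]] D(3)[OF \<sigma>V[OF representative_mem]] matrix_vector_mult_diff_distrib)
      then show ?thesis by (simp add: matrix_vector_mult_diff_distrib algebra_simps)
    qed
    ultimately show "\<exists>U t. orthogonal_matrix U \<and> (\<forall>x\<in>V. U *v p x + t = p (\<sigma> x))" by blast
  qed
  finally show ?thesis by (simp add: a_def)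
qed

end

section \<open>The correspondence between groups and affine sections\<close>

theorem corollary5:
  fixes V :: "'v set" and E :: "'v set set" and \<Gamma> :: "('v \<Rightarrow> 'v) set"
    and \<phi> :: "('d::finite \<Rightarrow>\<^sub>0 int) \<Rightarrow> 'v \<Rightarrow> 'v"
    and v :: "'n::finite \<Rightarrow> 'v" and i\<^sub>0 :: 'n
  assumes "periodic_graph CARD('d) V E \<Gamma>"
    and "\<phi> \<in> iso (free_Abelian_group (UNIV :: 'd set)) (period_group V E \<Gamma>)"
    and "orbit_representatives V E \<Gamma> v"
  shows "(\<forall>\<Sigma> \<in> crystallographic_subgroups V E \<Gamma>.
            fixed_parameters V E \<Gamma> \<phi> v i\<^sub>0 \<Sigma> =
              parameter_point \<phi> v i\<^sub>0 `
                {P. periodic_placement V E \<Gamma> P \<and> crystallographic_symmetry V E \<Gamma> \<Sigma> P} \<and>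
            fixed_parameters V E \<Gamma> \<phi> v i\<^sub>0 \<Sigma> \<noteq> {} \<and>
            (\<exists>L. affine L \<and> L \<subseteq> parameter_ambient i\<^sub>0 \<and>
                 fixed_parameters V E \<Gamma> \<phi> v i\<^sub>0 \<Sigma> = parameter_space i\<^sub>0 \<inter> L))
       \<and> finite (fixed_parameters V E \<Gamma> \<phi> v i\<^sub>0 ` crystallographic_subgroups V E \<Gamma>)
       \<and> (\<forall>\<Sigma>\<^sub>1 \<in> crystallographic_subgroups V E \<Gamma>. \<forall>\<Sigma>\<^sub>2 \<in> crystallographic_subgroups V E \<Gamma>.
            \<Sigma>\<^sub>1 \<subseteq> \<Sigma>\<^sub>2 \<longrightarrow> fixed_parameters V E \<Gamma> \<phi> v i\<^sub>0 \<Sigma>\<^sub>2 \<subseteq> fixed_parameters V E \<Gamma> \<phi> v i\<^sub>0 \<Sigma>\<^sub>1)"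
proof -
  interpret periodic_graph_coordinates V E \<Gamma> \<phi> v i\<^sub>0
    using assms by unfold_locales
  let ?\<F> = "fixed_parameters V E \<Gamma> \<phi> v i\<^sub>0"
  have sections: "?\<F> \<Sigma> = parameter_point \<phi> v i\<^sub>0 `
        {P. periodic_placement V E \<Gamma> P \<and> crystallographic_symmetry V E \<Gamma> \<Sigma> P} \<and>
      ?\<F> \<Sigma> \<noteq> {} \<and>
      (\<exists>L. affine L \<and> L \<subseteq> parameter_ambient i\<^sub>0 \<and> ?\<F> \<Sigma> = parameter_space i\<^sub>0 \<inter> L)"
    if \<Sigma>: "\<Sigma> \<in> crystallographic_subgroups V E \<Gamma>" for \<Sigma>
  proof (intro conjI)
    have sub: "subgroup \<Sigma> G" "\<Sigma> \<subseteq> N"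
      using \<Sigma> by (auto simp: crystallographic_subgroups_def)
    have sym: "crystallographic_symmetry V E \<Gamma> \<Sigma> P \<longleftrightarrow>
        (\<forall>\<sigma>\<in>\<Sigma>. affine_act \<sigma> (parameter_point \<phi> v i\<^sub>0 P) = parameter_point \<phi> v i\<^sub>0 P)"
      if "periodic_placement V E \<Gamma> P" for P
      unfolding crystallographic_symmetry_def
      using symmetry_iff_fixed[OF that] sub(2) by blast
    show "?\<F> \<Sigma> = parameter_point \<phi> v i\<^sub>0 `
        {P. periodic_placement V E \<Gamma> P \<and> crystallographic_symmetry V E \<Gamma> \<Sigma> P}"
    proof (intro subset_antisym subsetI)
      fix a assume "a \<in> ?\<F> \<Sigma>"
      then have a: "a \<in> parameter_space i\<^sub>0" "\<forall>\<sigma>\<in>\<Sigma>. affine_act \<sigma> a = a"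
        by (simp_all add: fixed_parameters_eq[OF \<Sigma>])
      obtain P where P: "periodic_placement V E \<Gamma> P" "parameter_point \<phi> v i\<^sub>0 P = a"
        using placement_exists[OF a(1)] .
      then show "a \<in> parameter_point \<phi> v i\<^sub>0 `
          {P. periodic_placement V E \<Gamma> P \<and> crystallographic_symmetry V E \<Gamma> \<Sigma> P}"
        using sym[OF P(1)] a(2) by (intro image_eqI[of _ _ P]) simp_all
    next
      fix a assume "a \<in> parameter_point \<phi> v i\<^sub>0 `
          {P. periodic_placement V E \<Gamma> P \<and> crystallographic_symmetry V E \<Gamma> \<Sigma> P}"
      then obtain P where P: "periodic_placement V E \<Gamma> P" "crystallographic_symmetry V E \<Gamma> \<Sigma> P"
        "a = parameter_point \<phi> v i\<^sub>0 P" by blast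
      then show "a \<in> ?\<F> \<Sigma>"
        using sym[OF P(1)] parameter_point_in_space[OF P(1)]
        by (simp add: fixed_parameters_eq[OF \<Sigma>])
    qed
    show "?\<F> \<Sigma> \<noteq> {}"
      using fixed_point_exists[OF sub] unfolding fixed_parameters_eq[OF \<Sigma>] by blast
    show "\<exists>L. affine L \<and> L \<subseteq> parameter_ambient i\<^sub>0 \<and> ?\<F> \<Sigma> = parameter_space i\<^sub>0 \<inter> L"
      unfolding fixed_parameters_eq[OF \<Sigma>]
      using affine_fixed[of \<Sigma>] parameter_space_subset_ambient[of i\<^sub>0]
      by (intro exI[of _ "{a \<in> parameter_ambient i\<^sub>0. \<forall>\<sigma>\<in>\<Sigma>. affine_act \<sigma> a = a}"]) blast
  qed
  have "?\<F> ` crystallographic_subgroups V E \<Gamma> \<subseteq>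
      (\<lambda>\<A>. {a \<in> parameter_space i\<^sub>0. \<forall>f\<in>\<A>. f a = a}) ` Pow (affine_act ` N)"
  proof (intro image_subsetI)
    fix \<Sigma> assume \<Sigma>: "\<Sigma> \<in> crystallographic_subgroups V E \<Gamma>"
    then have "affine_act ` \<Sigma> \<in> Pow (affine_act ` N)" by (auto simp: crystallographic_subgroups_def)
    then show "?\<F> \<Sigma> \<in> (\<lambda>\<A>. {a \<in> parameter_space i\<^sub>0. \<forall>f\<in>\<A>. f a = a}) ` Pow (affine_act ` N)"
      by (rule image_eqI[rotated]) (simp add: fixed_parameters_eq[OF \<Sigma>])
  qed
  then have "finite (?\<F> ` crystallographic_subgroups V E \<Gamma>)"
    using finite_affine_act by (meson finite_Pow_iff finite_imageI finite_subset)
  moreover have "?\<F> \<Sigma>\<^sub>2 \<subseteq> ?\<F> \<Sigma>\<^sub>1" if "\<Sigma>\<^sub>1 \<subseteq> \<Sigma>\<^sub>2" for \<Sigma>\<^sub>1 \<Sigma>\<^sub>2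
    using that by (auto simp: fixed_parameters_def)
  ultimately show ?thesis using sections by blast
qed

end
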